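(* For all integers $m\ge n\ge 2$, each $n$-chain group is isomorphic (as an abstract group) to some $m$-chain group.
   Context: $\mathrm{Homeo}^+(\mathbb{R})$ is the group of orientation preserving homeomorphisms of $\mathbb{R}$; $\operatorname{supp} f=\{x: f(x)\ne x\}$. For an interval $J$, $\partial^-J$ is its left endpoint. Chain of intervals: a collection $\{J_1,\ldots,J_n\}$ of nonempty open subintervals of $\mathbb{R}$ (possibly unbounded) such that $J_i\cap J_k=\varnothing$ if $|i-k|>1$, and $J_i\cap J_{i+1}$ is a proper nonempty subinterval of both $J_i$ and $J_{i+1}$ for $1\le i\le n-1$. $n$-chain group ($n\ge 2$): a group $\langle f_1,\ldots,f_n\rangle\le\mathrm{Homeo}^+(\mathbb{R})$ where $\{\operatorname{supp} f_1,\dots,\operatorname{supp} f_n\}$ is a chain of intervals with $\partial^-\operatorname{supp} f_i<\partial^-\operatorname{supp} f_{i+1}$ for all $i<n$, $f_i(t)\ge t$ for all $t$ and $i$, and $\langle f_i,f_{i+1}\rangle\cong F$ for each $1\le i\le n-1$. Here $F=\langle \{g_i\}_{i\ge0}\mid g_i^{-1}g_jg_i=g_{j+1}\text{ for }0\le i<j\rangle$ is Thompson's group. *)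

theory Defs
  imports "HOL-Analysis.Analysis" "HOL-Algebra.Elementary_Groups"
begin

text \<open>
  A letter \<open>(True, x)\<close> stands for the generator \<open>x\<close> and \<open>(False, x)\<close> for its formal inverse.
  \<open>pres_eq R\<close> relates two words iff they represent the same element of the group
  with all of \<open>'a\<close> as generators and with one relation \<open>l = r\<close> for each \<open>(l, r) \<in> R\<close>.
\<close>

type_synonym 'a word = "(bool \<times> 'a) list"

inductive_set pres_eq :: "('a word \<times> 'a word) set \<Rightarrow> ('a word \<times> 'a word) set"
  for R :: "('a word \<times> 'a word) set" where
  refl: "(u, u) \<in> pres_eq R"
| sym: "(u, v) \<in> pres_eq R \<Longrightarrow> (v, u) \<in> pres_eq R"
| trans: "(u, v) \<in> pres_eq R \<Longrightarrow> (v, w) \<in> pres_eq R \<Longrightarrow> (u, w) \<in> pres_eq R"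
| cancel: "(u @ [(b, x), (\<not> b, x)] @ v, u @ v) \<in> pres_eq R"
| relation: "(l, r) \<in> R \<Longrightarrow> (u @ l @ v, u @ r @ v) \<in> pres_eq R"

definition presented_group :: "('a word \<times> 'a word) set \<Rightarrow> 'a word set monoid" where
  "presented_group R =
     \<lparr>carrier = UNIV // pres_eq R,
      mult = (\<lambda>A B. \<Union>a\<in>A. \<Union>b\<in>B. pres_eq R `` {a @ b}),
      one = pres_eq R `` {[]}\<rparr>"

definition thompson_F :: "nat word set monoid" where
  "thompson_F = presented_group
     {([(False, i), (True, j), (True, i)], [(True, j + 1)]) | i j. i < j}"

lemma equiv_pres_eq: "equiv UNIV (pres_eq R)"
proof (rule equivI)
  show "refl_on UNIV (pres_eq R)" by (rule refl_onI) (rule pres_eq.refl)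
  show "sym_on UNIV (pres_eq R)" by (rule symI) (rule pres_eq.sym)
  show "trans_on UNIV (pres_eq R)" by (rule transI) (rule pres_eq.trans)
qed simp

lemma pres_eq_append_context:
  assumes "(u, v) \<in> pres_eq R"
  shows "(p @ u @ q, p @ v @ q) \<in> pres_eq R"
  using assms
proof induction
  case (refl u)
  show ?case by (rule pres_eq.refl)
next
  case (sym u v)
  from sym.IH show ?case by (rule pres_eq.sym)
next
  case (trans u v w)
  from trans.IH show ?case by (rule pres_eq.trans)
next
  case (cancel u b x v)
  show ?case using pres_eq.cancel[of "p @ u" b x "v @ q" R] by simp
next
  case (relation l r u v)
  show ?case using pres_eq.relation[OF relation, of "p @ u" "v @ q"] by simp
qed

lemma pres_eq_append:
  assumes "(u, u') \<in> pres_eq R" "(v, v') \<in> pres_eq R"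
  shows "(u @ v, u' @ v') \<in> pres_eq R"
proof (rule pres_eq.trans)
  show "(u @ v, u' @ v) \<in> pres_eq R"
    using pres_eq_append_context[OF assms(1), of "[]" v] by simp
  show "(u' @ v, u' @ v') \<in> pres_eq R"
    using pres_eq_append_context[OF assms(2), of u' "[]"] by simp
qed

lemma mult_presented_group:
  "pres_eq R `` {u} \<otimes>\<^bsub>presented_group R\<^esub> pres_eq R `` {v} = pres_eq R `` {u @ v}"
proof -
  have "congruent2 (pres_eq R) (pres_eq R) (\<lambda>a b. pres_eq R `` {a @ b})"
    by (intro congruent2I' equiv_class_eq[OF equiv_pres_eq] pres_eq_append)
  from UN_equiv_class2[OF equiv_pres_eq equiv_pres_eq this, of u v]
  show ?thesis by (simp add: presented_group_def)
qed

lemma group_presented_group: "group (presented_group R)"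
proof (rule groupI)
  fix A assume "A \<in> carrier (presented_group R)"
  then obtain u where A: "A = pres_eq R `` {u}"
    by (auto simp: presented_group_def quotient_def)
  have "\<exists>v. (v @ u, []) \<in> pres_eq R"
  proof (induction u)
    case (Cons l u)
    then obtain v where v: "(v @ u, []) \<in> pres_eq R" by blast
    obtain b x where l: "l = (b, x)" by (cases l)
    have "((v @ [(\<not> b, x)]) @ l # u, v @ u) \<in> pres_eq R"
      using pres_eq.cancel[of v "\<not> b" x u R] by (simp add: l)
    from pres_eq.trans[OF this v] show ?case by blast
  next
    case Nil
    have "([] @ [], []) \<in> pres_eq R" using pres_eq.refl by simp
    then show ?case by blast
  qed
  then obtain v where "(v @ u, []) \<in> pres_eq R" by blast
  then have "pres_eq R `` {v} \<otimes>\<^bsub>presented_group R\<^esub> A = \<one>\<^bsub>presented_group R\<^esub>"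
    by (simp add: A mult_presented_group equiv_class_eq[OF equiv_pres_eq])
       (simp add: presented_group_def)
  moreover have "pres_eq R `` {v} \<in> carrier (presented_group R)"
    by (simp add: presented_group_def quotientI)
  ultimately show "\<exists>B\<in>carrier (presented_group R). B \<otimes>\<^bsub>presented_group R\<^esub> A = \<one>\<^bsub>presented_group R\<^esub>"
    by blast
next
  have *: "\<exists>u. A = pres_eq R `` {u}" if "A \<in> carrier (presented_group R)" for A
    using that by (auto simp: presented_group_def quotient_def)
  have carr: "pres_eq R `` {u} \<in> carrier (presented_group R)" for u
    by (simp add: presented_group_def quotientI)
  have one: "\<one>\<^bsub>presented_group R\<^esub> = pres_eq R `` {[]}"
    by (simp add: presented_group_def)
  show "\<one>\<^bsub>presented_group R\<^esub> \<in> carrier (presented_group R)"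
    unfolding one by (rule carr)
  show "A \<otimes>\<^bsub>presented_group R\<^esub> B \<in> carrier (presented_group R)"
    if "A \<in> carrier (presented_group R)" "B \<in> carrier (presented_group R)" for A B
    using *[OF that(1)] *[OF that(2)] carr by (auto simp: mult_presented_group)
  show "A \<otimes>\<^bsub>presented_group R\<^esub> B \<otimes>\<^bsub>presented_group R\<^esub> C
      = A \<otimes>\<^bsub>presented_group R\<^esub> (B \<otimes>\<^bsub>presented_group R\<^esub> C)"
    if "A \<in> carrier (presented_group R)" "B \<in> carrier (presented_group R)"
      "C \<in> carrier (presented_group R)" for A B C
    using *[OF that(1)] *[OF that(2)] *[OF that(3)] by (auto simp: mult_presented_group)
  show "\<one>\<^bsub>presented_group R\<^esub> \<otimes>\<^bsub>presented_group R\<^esub> A = A"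
    if "A \<in> carrier (presented_group R)" for A
    using *[OF that] by (auto simp: one mult_presented_group)
qed

text \<open>A homeomorphism of the line preserves orientation iff it is increasing.\<close>

definition Homeo_plus :: "(real \<Rightarrow> real) monoid" where
  "Homeo_plus =
     \<lparr>carrier = {f. strict_mono f \<and> (\<exists>g. homeomorphism UNIV UNIV f g)},
      mult = (\<circ>), one = id\<rparr>"

lemma group_Homeo_plus: "group Homeo_plus"
proof (rule groupI)
  fix f assume "f \<in> carrier Homeo_plus"
  then obtain g where f: "strict_mono f" and g: "homeomorphism UNIV UNIV f g"
    by (auto simp: Homeo_plus_def)
  have fg: "f (g y) = y" and gf: "g (f y) = y" for y
    using homeomorphism_apply1[OF g] homeomorphism_apply2[OF g] by simp_all
  have "strict_mono g"
  proof (rule strict_monoI)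
    fix x y :: real assume "x < y"
    then have "f (g x) < f (g y)" by (simp only: fg)
    then show "g x < g y" using strict_mono_less[OF f] by blast
  qed
  moreover have "homeomorphism UNIV UNIV g f"
    using g by (rule homeomorphism_symD)
  ultimately have "g \<in> carrier Homeo_plus"
    by (auto simp: Homeo_plus_def)
  moreover have "g \<otimes>\<^bsub>Homeo_plus\<^esub> f = \<one>\<^bsub>Homeo_plus\<^esub>"
    by (simp add: Homeo_plus_def fun_eq_iff gf)
  ultimately show "\<exists>g\<in>carrier Homeo_plus. g \<otimes>\<^bsub>Homeo_plus\<^esub> f = \<one>\<^bsub>Homeo_plus\<^esub>"
    by blast
next
  fix f g assume "f \<in> carrier Homeo_plus" "g \<in> carrier Homeo_plus"
  then show "f \<otimes>\<^bsub>Homeo_plus\<^esub> g \<in> carrier Homeo_plus"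
    by (auto simp: Homeo_plus_def strict_mono_def intro: homeomorphism_compose)
next
  have "homeomorphism (UNIV :: real set) UNIV id id"
    unfolding id_def by (rule homeomorphism_ident)
  then show "\<one>\<^bsub>Homeo_plus\<^esub> \<in> carrier Homeo_plus"
    by (auto simp: Homeo_plus_def strict_mono_def)
qed (auto simp: Homeo_plus_def comp_assoc)

text \<open>The set of moved points itself, not its closure.\<close>

definition supp :: "(real \<Rightarrow> real) \<Rightarrow> real set" where
  "supp f = {x. f x \<noteq> x}"

definition left_endpoint :: "real set \<Rightarrow> ereal" where
  "left_endpoint J = (INF x\<in>J. ereal x)"

text \<open>The intersection of two intervals is an interval, so being a proper subinterval
  amounts to being a proper subset.\<close>

definition chain_of_intervals :: "nat \<Rightarrow> (nat \<Rightarrow> real set) \<Rightarrow> bool" where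
  "chain_of_intervals n J \<longleftrightarrow>
     (\<forall>i\<in>{1..n}. J i \<noteq> {} \<and> open (J i) \<and> is_interval (J i)) \<and>
     (\<forall>i\<in>{1..n}. \<forall>k\<in>{1..n}. \<bar>int i - int k\<bar> > 1 \<longrightarrow> J i \<inter> J k = {}) \<and>
     (\<forall>i\<in>{1..<n}. J i \<inter> J (i + 1) \<noteq> {} \<and>
        J i \<inter> J (i + 1) \<subset> J i \<and> J i \<inter> J (i + 1) \<subset> J (i + 1))"

definition chain_group :: "nat \<Rightarrow> (real \<Rightarrow> real) monoid \<Rightarrow> bool" where
  "chain_group n G \<longleftrightarrow> n \<ge> 2 \<and>
     (\<exists>f :: nat \<Rightarrow> real \<Rightarrow> real.
        (\<forall>i\<in>{1..n}. f i \<in> carrier Homeo_plus) \<and>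
        chain_of_intervals n (\<lambda>i. supp (f i)) \<and>
        (\<forall>i\<in>{1..<n}. left_endpoint (supp (f i)) < left_endpoint (supp (f (i + 1)))) \<and>
        (\<forall>i\<in>{1..n}. \<forall>t. f i t \<ge> t) \<and>
        (\<forall>i\<in>{1..<n}. subgroup_generated Homeo_plus {f i, f (i + 1)} \<cong> thompson_F) \<and>
        G = subgroup_generated Homeo_plus (f ` {1..n}))"

end

theory Submission
  imports Defs
begin

text \<open>
  A chain group is itself a chain group with one more generator: only the last generator \<open>g = f\<^sub>n\<close>
  has to be split. Let \<open>f = f\<^sub>n\<^sub>-\<^sub>1\<close>, with the support of \<open>f\<close> ending at \<open>b\<close> and that of \<open>g\<close> starting
  at \<open>a < b\<close>. Choose \<open>k\<close> with \<open>b \<le> g (f\<^sup>k a)\<close> and put \<open>h = g f\<^sup>k\<close>, \<open>w = h g h\<inverse>\<close>, \<open>v = g w\<inverse>\<close>. Then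
  \<open>g = v w\<close>, and \<open>v\<close>, \<open>w\<close> lie in the group generated by \<open>f\<close> and \<open>g\<close>. The support of \<open>w\<close> starts at
  \<open>c = h a \<ge> b\<close>, the support of \<open>v\<close> is the interval from \<open>a\<close> to \<open>d = g (g b) > c\<close>, and \<open>v\<close> moves points
  to the right.

  Since \<open>v\<close> agrees with \<open>g\<close> to the left of \<open>c\<close>, beyond the support of \<open>f\<close>, the pairs \<open>(f, v)\<close> and
  \<open>(f, g)\<close> are conjugate on the unions of their supports, so the first one generates a copy of
  Thompson's group because the second one does. The pair \<open>(v, w)\<close> does so because \<open>w (v c) \<ge> d\<close>: this
  inequality forces the relations of Thompson's group, and the normal form of its elements shows
  that there are no others.
\<close>

section \<open>Words and presentations\<close>

fun word_val :: "('b, 'c) monoid_scheme \<Rightarrow> ('a \<Rightarrow> 'b) \<Rightarrow> 'a word \<Rightarrow> 'b" where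
  "word_val G s [] = \<one>\<^bsub>G\<^esub>"
| "word_val G s ((b, x) # u) = (if b then s x else inv\<^bsub>G\<^esub> s x) \<otimes>\<^bsub>G\<^esub> word_val G s u"

context group
begin

lemma word_val_closed [simp]:
  assumes "\<And>x. s x \<in> carrier G"
  shows "word_val G s u \<in> carrier G"
  by (induction u) (auto simp: assms)

lemma word_val_append:
  assumes "\<And>x. s x \<in> carrier G"
  shows "word_val G s (u @ v) = word_val G s u \<otimes> word_val G s v"
  by (induction u) (auto simp: assms m_assoc)

lemma word_val_pres_eq:
  assumes s: "\<And>x. s x \<in> carrier G"
    and R: "\<And>l r. (l, r) \<in> R \<Longrightarrow> word_val G s l = word_val G s r"
    and "(u, v) \<in> pres_eq R"
  shows "word_val G s u = word_val G s v"
  using assms(3)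
proof induction
  case (cancel u b x v)
  have "inv s x \<otimes> (s x \<otimes> word_val G s v) = word_val G s v"
    "s x \<otimes> (inv s x \<otimes> word_val G s v) = word_val G s v"
    by (simp_all add: s flip: m_assoc)
  then show ?case
    by (simp add: word_val_append s m_assoc)
qed (simp_all add: word_val_append s R)

lemma generate_range_eq_word_val:
  assumes s: "\<And>x. s x \<in> carrier G"
  shows "generate G (range s) = range (word_val G s)"
proof (intro equalityI subsetI)
  fix k assume "k \<in> generate G (range s)"
  then show "k \<in> range (word_val G s)"
  proof induction
    case one
    show ?case by (rule range_eqI[of _ _ "[]"]) simp
  next
    case (incl h)
    then obtain x where "h = s x" by blast
    then show ?case by (intro range_eqI[of _ _ "[(True, x)]"]) (simp add: s)
  next
    case (inv h)
    then obtain x where "h = s x" by blast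
    then show ?case by (intro range_eqI[of _ _ "[(False, x)]"]) (simp add: s)
  next
    case (eng h k)
    then obtain u v where "h = word_val G s u" "k = word_val G s v" by blast
    then show ?case by (intro range_eqI[of _ _ "u @ v"]) (simp add: word_val_append s)
  qed
next
  fix k assume "k \<in> range (word_val G s)"
  then obtain u where "k = word_val G s u" by blast
  moreover have "word_val G s u \<in> generate G (range s)"
    by (induction u) (auto intro!: generate.one generate.eng[OF generate.incl] generate.eng[OF generate.inv])
  ultimately show "k \<in> generate G (range s)" by simp
qed

lemma subgroup_generated_iso_presented_group:
  assumes s: "\<And>x. s x \<in> carrier G"
    and R: "\<And>u v. (u, v) \<in> pres_eq R \<longleftrightarrow> word_val G s u = word_val G s v"
  shows "subgroup_generated G (range s) \<cong> presented_group R"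
proof -
  let ?H = "subgroup_generated G (range s)" and ?\<psi> = "\<lambda>k. {u. word_val G s u = k}"
  have \<psi>: "?\<psi> (word_val G s u) = pres_eq R `` {u}" for u
    using R by auto
  have carr: "carrier ?H = range (word_val G s)"
    using s by (simp add: carrier_subgroup_generated generate_range_eq_word_val Int_absorb1
        image_subset_iff)
  have "?\<psi> \<in> hom ?H (presented_group R)"
  proof (rule homI)
    fix k assume "k \<in> carrier ?H"
    then obtain u where k: "k = word_val G s u" unfolding carr by blast
    show "?\<psi> k \<in> carrier (presented_group R)"
      unfolding k \<psi> by (simp add: presented_group_def quotientI)
    fix l assume "l \<in> carrier ?H"
    then obtain v where l: "l = word_val G s v" unfolding carr by blast
    have "k \<otimes>\<^bsub>?H\<^esub> l = word_val G s (u @ v)"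
      by (simp add: k l word_val_append s)
    then show "?\<psi> (k \<otimes>\<^bsub>?H\<^esub> l) = ?\<psi> k \<otimes>\<^bsub>presented_group R\<^esub> ?\<psi> l"
      using \<psi>[of "u @ v"] by (simp only: k l \<psi> mult_presented_group)
  qed
  moreover have "bij_betw ?\<psi> (carrier ?H) (carrier (presented_group R))"
  proof (rule bij_betwI')
    fix k l assume "k \<in> carrier ?H" "l \<in> carrier ?H"
    then show "?\<psi> k = ?\<psi> l \<longleftrightarrow> k = l" unfolding carr by blast
  next
    fix k assume "k \<in> carrier ?H"
    then obtain u where k: "k = word_val G s u" unfolding carr by blast
    show "?\<psi> k \<in> carrier (presented_group R)"
      unfolding k \<psi> by (simp add: presented_group_def quotientI)
  next
    fix A assume "A \<in> carrier (presented_group R)"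
    then obtain u where "A = pres_eq R `` {u}"
      by (auto simp: presented_group_def quotient_def)
    then show "\<exists>k\<in>carrier ?H. A = ?\<psi> k" unfolding carr \<psi>[symmetric] by blast
  qed
  ultimately show ?thesis
    unfolding is_iso_def iso_def by blast
qed

text \<open>Both groups are presented by the set of all relations that hold in them.\<close>

lemma subgroup_generated_iso:
  assumes s: "\<And>x. s x \<in> carrier G" and t: "\<And>x. t x \<in> carrier G"
    and st: "\<And>u v. word_val G s u = word_val G s v \<longleftrightarrow> word_val G t u = word_val G t v"
  shows "subgroup_generated G (range s) \<cong> subgroup_generated G (range t)"
proof -
  define R where "R = {(u, v). word_val G s u = word_val G s v}"
  have R: "(u, v) \<in> pres_eq R \<longleftrightarrow> word_val G s u = word_val G s v" for u v
    using word_val_pres_eq[of s R u v] s pres_eq.relation[of u v R "[]" "[]"]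
    by (auto simp: R_def)
  have "subgroup_generated G (range s) \<cong> presented_group R"
    using s R by (rule subgroup_generated_iso_presented_group)
  moreover have "subgroup_generated G (range t) \<cong> presented_group R"
    by (rule subgroup_generated_iso_presented_group[OF t]) (simp add: R st)
  ultimately show ?thesis
    using group.iso_sym[OF group_subgroup_generated] iso_trans by blast
qed

end

section \<open>Normal forms in Thompson's group\<close>

definition inverse_word :: "'a word \<Rightarrow> 'a word" where
  "inverse_word u = rev (map (\<lambda>(b, x). (\<not> b, x)) u)"

lemma append_inverse_word: "(u @ inverse_word u, []) \<in> pres_eq R"
proof (induction u)
  case Nil
  show ?case by (simp add: inverse_word_def pres_eq.refl)
next
  case (Cons l u)
  obtain b x where l: "l = (b, x)" by (cases l)
  have "([l] @ (u @ inverse_word u) @ [(\<not> b, x)], [l] @ [] @ [(\<not> b, x)]) \<in> pres_eq R"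
    using Cons by (rule pres_eq_append_context)
  also have "([l] @ [] @ [(\<not> b, x)], []) \<in> pres_eq R"
    using pres_eq.cancel[of "[]" b x "[]" R] by (simp add: l)
  finally (pres_eq.trans) show ?case by (simp add: l inverse_word_def)
qed

lemma inverse_word_append: "(inverse_word u @ u, []) \<in> pres_eq R"
  using append_inverse_word[of "inverse_word u" R]
  by (simp add: inverse_word_def rev_map case_prod_beta comp_def)

definition thompson_rel :: "(nat word \<times> nat word) set" where
  "thompson_rel = {([(False, i), (True, j), (True, i)], [(True, j + 1)]) | i j. i < j}"

definition thompson_eq :: "nat word \<Rightarrow> nat word \<Rightarrow> bool" (infix "\<sim>\<^sub>F" 50) where
  "u \<sim>\<^sub>F v \<longleftrightarrow> (u, v) \<in> pres_eq thompson_rel"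

lemma thompson_eq_refl [simp]: "u \<sim>\<^sub>F u"
  unfolding thompson_eq_def by (rule pres_eq.refl)

lemma thompson_eq_sym: "u \<sim>\<^sub>F v \<Longrightarrow> v \<sim>\<^sub>F u"
  unfolding thompson_eq_def by (rule pres_eq.sym)

lemma thompson_eq_trans [trans]: "u \<sim>\<^sub>F v \<Longrightarrow> v \<sim>\<^sub>F w \<Longrightarrow> u \<sim>\<^sub>F w"
  unfolding thompson_eq_def by (rule pres_eq.trans)

lemma thompson_eq_context: "u \<sim>\<^sub>F v \<Longrightarrow> p @ u @ q \<sim>\<^sub>F p @ v @ q"
  unfolding thompson_eq_def by (rule pres_eq_append_context)

lemma thompson_eq_Cons: "u \<sim>\<^sub>F v \<Longrightarrow> a # u \<sim>\<^sub>F a # v"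
  using thompson_eq_context[of u v "[a]" "[]"] by simp

lemma thompson_eq_cancel: "(b, i) # (\<not> b, i) # u \<sim>\<^sub>F u"
  using pres_eq.cancel[of "[]" b i u thompson_rel] by (simp add: thompson_eq_def)

lemma thompson_eq_neg_pos:
  assumes "i < j"
  shows "(False, i) # (True, j) # u \<sim>\<^sub>F (True, j + 1) # (False, i) # u"
proof -
  have "(False, i) # (True, j) # u \<sim>\<^sub>F [(False, i), (True, j), (True, i), (False, i)] @ u"
    using thompson_eq_sym[OF thompson_eq_cancel[of True i u]] thompson_eq_Cons by simp
  also have "[(False, i), (True, j), (True, i), (False, i)] @ u \<sim>\<^sub>F (True, j + 1) # (False, i) # u"
    using pres_eq.relation[of "[(False, i), (True, j), (True, i)]" "[(True, j + 1)]"
        thompson_rel "[]" "(False, i) # u"] assms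
    by (simp add: thompson_rel_def thompson_eq_def)
  finally show ?thesis .
qed

lemma thompson_eq_pos_pos:
  assumes "i < j"
  shows "(True, j) # (True, i) # u \<sim>\<^sub>F (True, i) # (True, j + 1) # u"
proof -
  have "(True, j) # (True, i) # u \<sim>\<^sub>F (True, i) # (False, i) # (True, j) # (True, i) # u"
    using thompson_eq_sym[OF thompson_eq_cancel[of True i]] by simp
  also have "\<dots> \<sim>\<^sub>F (True, i) # (True, j + 1) # (False, i) # (True, i) # u"
    using assms by (intro thompson_eq_Cons thompson_eq_neg_pos)
  also have "\<dots> \<sim>\<^sub>F (True, i) # (True, j + 1) # u"
    using thompson_eq_cancel[of False i] by (simp add: thompson_eq_Cons)
  finally show ?thesis .
qed

lemma thompson_eq_neg_pos':
  assumes "i < j"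
  shows "(False, j) # (True, i) # u \<sim>\<^sub>F (True, i) # (False, j + 1) # u"
proof -
  have "(False, j) # (True, i) # u \<sim>\<^sub>F (False, j) # (True, i) # (True, j + 1) # (False, j + 1) # u"
    using thompson_eq_sym[OF thompson_eq_cancel[of True "j + 1" u]] by (simp add: thompson_eq_Cons)
  also have "\<dots> \<sim>\<^sub>F (False, j) # (True, j) # (True, i) # (False, j + 1) # u"
    using assms by (intro thompson_eq_Cons thompson_eq_sym[OF thompson_eq_pos_pos])
  also have "\<dots> \<sim>\<^sub>F (True, i) # (False, j + 1) # u"
    using thompson_eq_cancel[of False j] by simp
  finally show ?thesis .
qed

abbreviation pos_word :: "nat list \<Rightarrow> nat word" where "pos_word \<equiv> map (Pair True)"
abbreviation neg_word :: "nat list \<Rightarrow> nat word" where "neg_word \<equiv> map (Pair False)"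

lemma neg_letter_pos:
  "\<exists>p' q. (False, i) # pos_word p \<sim>\<^sub>F pos_word p' @ neg_word q"
proof (induction p arbitrary: i)
  case Nil
  have "(False, i) # pos_word [] \<sim>\<^sub>F pos_word [] @ neg_word [i]" by simp
  then show ?case by blast
next
  case (Cons j p)
  consider "i = j" | "i < j" | "j < i" by linarith
  then show ?case
  proof cases
    case 1
    then have "(False, i) # pos_word (j # p) \<sim>\<^sub>F pos_word p @ neg_word []"
      using thompson_eq_cancel[of False i "pos_word p"] by simp
    then show ?thesis by blast
  next
    case 2
    obtain p' q where "(False, i) # pos_word p \<sim>\<^sub>F pos_word p' @ neg_word q" using Cons.IH by blast
    then have "(False, i) # pos_word (j # p) \<sim>\<^sub>F pos_word ((j + 1) # p') @ neg_word q"
      using thompson_eq_trans[OF thompson_eq_neg_pos[OF 2, of "pos_word p"] thompson_eq_Cons] by simp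
    then show ?thesis by blast
  next
    case 3
    obtain p' q where "(False, i + 1) # pos_word p \<sim>\<^sub>F pos_word p' @ neg_word q" using Cons.IH by blast
    then have "(False, i) # pos_word (j # p) \<sim>\<^sub>F pos_word (j # p') @ neg_word q"
      using thompson_eq_trans[OF thompson_eq_neg_pos'[OF 3, of "pos_word p"] thompson_eq_Cons] by simp
    then show ?thesis by blast
  qed
qed

lemma thompson_eq_pos_neg: "\<exists>p q. u \<sim>\<^sub>F pos_word p @ neg_word q"
proof (induction u)
  case Nil
  have "[] \<sim>\<^sub>F pos_word [] @ neg_word []" by simp
  then show ?case by blast
next
  case (Cons l u)
  obtain b i where l: "l = (b, i)" by (cases l)
  obtain p q where "u \<sim>\<^sub>F pos_word p @ neg_word q" using Cons.IH by blast
  then have *: "l # u \<sim>\<^sub>F (b, i) # pos_word p @ neg_word q" unfolding l by (rule thompson_eq_Cons)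
  show ?case
  proof (cases b)
    case True
    with * have "l # u \<sim>\<^sub>F pos_word (i # p) @ neg_word q" by simp
    then show ?thesis by blast
  next
    case False
    obtain p' q' where "(False, i) # pos_word p \<sim>\<^sub>F pos_word p' @ neg_word q'" using neg_letter_pos by blast
    then have "(False, i) # pos_word p @ neg_word q \<sim>\<^sub>F pos_word p' @ neg_word (q' @ q)"
      using thompson_eq_context[of "(False, i) # pos_word p" "pos_word p' @ neg_word q'" "[]" "neg_word q"] by simp
    from thompson_eq_trans[OF _ this] * False have "l # u \<sim>\<^sub>F pos_word p' @ neg_word (q' @ q)" by simp
    then show ?thesis by blast
  qed
qed

lemma insert_sorted:
  assumes "sorted p"
  shows "\<exists>r. sorted r \<and> pos_word (j # p) \<sim>\<^sub>F pos_word r \<and> (\<forall>k\<in>set r. k \<in> set p \<or> j \<le> k)"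
  using assms
proof (induction p arbitrary: j)
  case Nil
  show ?case by (intro exI[of _ "[j]"]) simp
next
  case (Cons i p)
  then have p: "sorted p" "\<forall>k\<in>set p. i \<le> k" by simp_all
  show ?case
  proof (cases "j \<le> i")
    case True
    with p have "sorted (j # i # p)" by fastforce
    then show ?thesis by (intro exI[of _ "j # i # p"]) simp
  next
    case False
    obtain r where r: "sorted r" "pos_word ((j + 1) # p) \<sim>\<^sub>F pos_word r"
        "\<forall>k\<in>set r. k \<in> set p \<or> j + 1 \<le> k"
      using Cons.IH[OF p(1)] by blast
    have "pos_word (j # i # p) \<sim>\<^sub>F (True, i) # pos_word ((j + 1) # p)"
      using False thompson_eq_pos_pos[of i j] by simp
    also have "(True, i) # pos_word ((j + 1) # p) \<sim>\<^sub>F pos_word (i # r)"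
      using thompson_eq_Cons[OF r(2)] by simp
    finally have "pos_word (j # i # p) \<sim>\<^sub>F pos_word (i # r)" .
    moreover have "sorted (i # r)"
      using r(1,3) p(2) False by fastforce
    moreover have "k \<in> set (i # p) \<or> j \<le> k" if "k \<in> set (i # r)" for k
      using r(3) that by fastforce
    ultimately show ?thesis by (intro exI[of _ "i # r"]) blast
  qed
qed

lemma thompson_eq_sorted: "\<exists>r. sorted r \<and> pos_word p \<sim>\<^sub>F pos_word r"
proof (induction p)
  case Nil
  show ?case by (intro exI[of _ "[]"]) simp
next
  case (Cons j p)
  then obtain r where r: "sorted r" "pos_word p \<sim>\<^sub>F pos_word r" by blast
  then obtain r' where r': "sorted r'" "pos_word (j # r) \<sim>\<^sub>F pos_word r'" using insert_sorted by blast
  have "pos_word (j # p) \<sim>\<^sub>F pos_word (j # r)" using thompson_eq_Cons[OF r(2)] by simp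
  also note r'(2)
  finally show ?case using r'(1) by blast
qed

section \<open>Increasing homeomorphisms of the line\<close>

lemma mult_Homeo_plus [simp]: "f \<otimes>\<^bsub>Homeo_plus\<^esub> g = f \<circ> g"
  by (simp add: Homeo_plus_def)

lemma one_Homeo_plus [simp]: "\<one>\<^bsub>Homeo_plus\<^esub> = id"
  by (simp add: Homeo_plus_def)

abbreviation finv :: "('a \<Rightarrow> 'b) \<Rightarrow> 'b \<Rightarrow> 'a" where "finv \<equiv> inv_into UNIV"

lemma carrier_Homeo_plus: "carrier Homeo_plus = {f. strict_mono f \<and> surj f}"
proof (intro equalityI subsetI)
  fix f assume "f \<in> carrier Homeo_plus"
  then obtain g where "strict_mono f" "homeomorphism UNIV UNIV f g"
    unfolding Homeo_plus_def by auto
  then show "f \<in> {f. strict_mono f \<and> surj f}"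
    using homeomorphism_image1 by blast
next
  fix f :: "real \<Rightarrow> real" assume "f \<in> {f. strict_mono f \<and> surj f}"
  then have f: "strict_mono f" "surj f" by auto
  then have "bij f" by (simp add: bij_def strict_mono_imp_inj_on)
  then have inv: "finv f y = x \<longleftrightarrow> y = f x" for x y
    by (metis bij_inv_eq_iff)
  have "continuous_on UNIV f"
    using f by (intro continuous_onI_mono) (simp_all add: strict_mono_less_eq)
  moreover have "finv f x \<le> finv f y" if "x \<le> y" for x y
    using that strict_mono_less_eq[OF f(1), of "finv f x" "finv f y"] inv by metis
  then have "continuous_on UNIV (finv f)"
    using bij_is_surj[OF bij_imp_bij_inv[OF \<open>bij f\<close>]]
    by (intro continuous_onI_mono) simp_all
  ultimately have "homeomorphism UNIV UNIV f (finv f)"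
    using inv by (intro homeomorphismI) (auto, metis)
  with f(1) show "f \<in> carrier Homeo_plus"
    unfolding Homeo_plus_def by auto
qed

lemma Homeo_plus_bij: "f \<in> carrier Homeo_plus \<Longrightarrow> bij f"
  by (auto simp: carrier_Homeo_plus bij_def strict_mono_imp_inj_on)

lemma Homeo_plus_less_iff: "f \<in> carrier Homeo_plus \<Longrightarrow> f x < f y \<longleftrightarrow> x < y"
  by (auto simp: carrier_Homeo_plus strict_mono_less)

lemma Homeo_plus_le_iff: "f \<in> carrier Homeo_plus \<Longrightarrow> f x \<le> f y \<longleftrightarrow> x \<le> y"
  by (auto simp: carrier_Homeo_plus strict_mono_less_eq)

lemma Homeo_plus_eq_iff: "f \<in> carrier Homeo_plus \<Longrightarrow> f x = f y \<longleftrightarrow> x = y"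
  by (auto simp: carrier_Homeo_plus strict_mono_eq)

lemma comp_Homeo_plus:
  "f \<in> carrier Homeo_plus \<Longrightarrow> g \<in> carrier Homeo_plus \<Longrightarrow> f \<circ> g \<in> carrier Homeo_plus"
  using monoid.m_closed[OF group.is_monoid[OF group_Homeo_plus]] by simp

lemma inv_Homeo_plus:
  assumes "f \<in> carrier Homeo_plus"
  shows "inv\<^bsub>Homeo_plus\<^esub> f \<in> carrier Homeo_plus"
  using group.inv_closed[OF group_Homeo_plus assms] .

lemma m_inv_Homeo_plus:
  assumes f: "f \<in> carrier Homeo_plus"
  shows "inv\<^bsub>Homeo_plus\<^esub> f = finv f"
proof -
  have *: "f \<circ> inv\<^bsub>Homeo_plus\<^esub> f = id"
    using group.r_inv[OF group_Homeo_plus f] by simp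
  show ?thesis
  proof
    fix x
    have "f ((inv\<^bsub>Homeo_plus\<^esub> f) x) = x"
      using fun_cong[OF *, of x] by simp
    then show "(inv\<^bsub>Homeo_plus\<^esub> f) x = finv f x"
      using bij_inv_eq_iff[OF Homeo_plus_bij[OF f]] by metis
  qed
qed

lemma inv_in_Homeo_plus: "f \<in> carrier Homeo_plus \<Longrightarrow> finv f \<in> carrier Homeo_plus"
  using inv_Homeo_plus m_inv_Homeo_plus by metis

lemma Homeo_plus_inv_eq: "f \<in> carrier Homeo_plus \<Longrightarrow> finv f y = x \<longleftrightarrow> y = f x"
  using Homeo_plus_bij bij_inv_eq_iff by metis

lemma Homeo_plus_f_inv_f: "f \<in> carrier Homeo_plus \<Longrightarrow> f (finv f y) = y"
  using Homeo_plus_inv_eq by metis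

lemma Homeo_plus_inv_f_f: "f \<in> carrier Homeo_plus \<Longrightarrow> finv f (f x) = x"
  using Homeo_plus_inv_eq by metis

lemma funpow_Homeo_plus: "f \<in> carrier Homeo_plus \<Longrightarrow> f ^^ n \<in> carrier Homeo_plus"
proof (induction n)
  case 0
  show ?case using monoid.one_closed[OF group.is_monoid[OF group_Homeo_plus]] by (simp add: id_def)
qed (auto intro: comp_Homeo_plus)

lemma (in group) subgroup_generated_eqI:
  assumes "S \<subseteq> carrier G" "T \<subseteq> carrier G" "S \<subseteq> generate G T" "T \<subseteq> generate G S"
  shows "subgroup_generated G S = subgroup_generated G T"
proof -
  have "generate G S = generate G T"
    using assms by (intro equalityI generate_subgroup_incl generate_is_subgroup)
  with assms(1,2) show ?thesis by (simp add: subgroup_generated_def Int_absorb1)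
qed

lemma subgroup_Homeo_plus_comp:
  "subgroup K Homeo_plus \<Longrightarrow> f \<in> K \<Longrightarrow> g \<in> K \<Longrightarrow> f \<circ> g \<in> K"
  using subgroup.m_closed[of K Homeo_plus f g] by simp

lemma subgroup_Homeo_plus_inv:
  "subgroup K Homeo_plus \<Longrightarrow> f \<in> K \<Longrightarrow> finv f \<in> K"
  using subgroup.m_inv_closed[of K Homeo_plus f] subgroup.mem_carrier[of K Homeo_plus f]
  by (simp add: m_inv_Homeo_plus)

lemma subgroup_Homeo_plus_funpow:
  assumes "subgroup K Homeo_plus" "f \<in> K"
  shows "f ^^ n \<in> K"
proof (induction n)
  case 0
  show ?case using subgroup.one_closed[OF assms(1)] by (simp add: id_def)
next
  case (Suc n)
  show ?case unfolding funpow.simps by (rule subgroup_Homeo_plus_comp[OF assms Suc.IH])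
qed

lemma Homeo_plus_obtain_preimage:
  assumes "f \<in> carrier Homeo_plus"
  obtains x where "y = f x"
  using Homeo_plus_f_inv_f[OF assms] by metis

lemma funpow_ge:
  fixes f :: "real \<Rightarrow> real"
  assumes "\<And>t. t \<le> f t"
  shows "x \<le> (f ^^ n) x"
  by (induction n) (use assms order_trans in auto)

lemma funpow_exceeds:
  assumes k: "k \<in> carrier Homeo_plus" and gt: "\<And>y. c \<le> y \<Longrightarrow> y \<le> x \<Longrightarrow> y < k y"
  shows "\<exists>n. x \<le> (k ^^ n) c"
proof (rule ccontr)
  assume "\<nexists>n. x \<le> (k ^^ n) c"
  then have lt: "(k ^^ n) c < x" for n by (simp add: not_le)
  define L where "L = (SUP n. (k ^^ n) c)"
  have bdd: "bdd_above (range (\<lambda>n. (k ^^ n) c))"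
    using lt by (intro bdd_aboveI[of _ x]) (auto intro: less_imp_le)
  have le: "(k ^^ n) c \<le> L" for n
    unfolding L_def using bdd by (intro cSUP_upper) auto
  have "L \<le> x"
    unfolding L_def using lt by (intro cSUP_least) (auto intro: less_imp_le)
  with le[of 0] gt have "L < k L" by simp
  then have "finv k L < L"
    using Homeo_plus_less_iff[OF k, of "finv k L" L] Homeo_plus_f_inv_f[OF k] by simp
  then obtain n where "finv k L < (k ^^ n) c"
    unfolding L_def using bdd by (subst (asm) less_cSUP_iff) (auto simp: L_def)
  then have "L < (k ^^ Suc n) c"
    using Homeo_plus_less_iff[OF k, of "finv k L" "(k ^^ n) c"] Homeo_plus_f_inv_f[OF k] by simp
  with le[of "Suc n"] show False by simp
qed

lemma commute_disjoint:
  assumes f: "f \<in> carrier Homeo_plus" and g: "g \<in> carrier Homeo_plus"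
    and "\<And>x. b \<le> x \<Longrightarrow> f x = x" "\<And>x. x \<le> b \<Longrightarrow> g x = x"
  shows "f (g x) = g (f x)"
proof (cases "x \<le> b")
  case True
  then have "f x \<le> b" using Homeo_plus_le_iff[OF f, of x b] assms(3)[of b] by simp
  with True show ?thesis using assms(4) by simp
next
  case False
  then have "b \<le> g x" using Homeo_plus_le_iff[OF g, of b x] assms(4)[of b] by simp
  with False show ?thesis using assms(3) by simp
qed

section \<open>Recognizing Thompson's group\<close>

abbreviation homeo_val :: "('a \<Rightarrow> real \<Rightarrow> real) \<Rightarrow> 'a word \<Rightarrow> real \<Rightarrow> real" where
  "homeo_val \<equiv> word_val Homeo_plus"

lemma word_val_pos_le:
  assumes s: "\<And>i. s i \<in> carrier Homeo_plus" and le: "\<And>i t. s i t \<le> t"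
  shows "homeo_val s (pos_word p) t \<le> t"
proof (induction p)
  case (Cons i p)
  have "s i (homeo_val s (pos_word p) t) \<le> homeo_val s (pos_word p) t" by (rule le)
  with Cons show ?case by (simp add: m_inv_Homeo_plus s)
qed simp

lemma word_val_pos_fixed:
  assumes "\<And>i. i \<in> set p \<Longrightarrow> s i t = t"
  shows "homeo_val s (pos_word p) t = t"
  using assms by (induction p) simp_all

text \<open>Two different sorted words can be told apart at the points \<open>\<tau> i\<close>: after cancelling a common
  prefix, exactly one of them moves \<open>\<tau> i\<close> for the smallest remaining letter \<open>i\<close>.\<close>

lemma word_val_pos_inj:
  fixes s :: "nat \<Rightarrow> real \<Rightarrow> real"
  assumes s: "\<And>i. s i \<in> carrier Homeo_plus" and le: "\<And>i t. s i t \<le> t"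
    and fixed: "\<And>i j. i < j \<Longrightarrow> s j (\<tau> i) = \<tau> i"
    and moved: "\<And>i. s i (\<tau> i) < \<tau> i"
    and "sorted p" "sorted q" "homeo_val s (pos_word p) = homeo_val s (pos_word q)"
  shows "p = q"
proof -
  have neq: "homeo_val s (pos_word (i # p)) \<noteq> homeo_val s (pos_word q)" if "\<And>j. j \<in> set q \<Longrightarrow> i < j" for i p q
  proof -
    have "homeo_val s (pos_word q) (\<tau> i) = \<tau> i"
      using that fixed by (intro word_val_pos_fixed) auto
    moreover have "s i (homeo_val s (pos_word p) (\<tau> i)) \<le> s i (\<tau> i)"
      using word_val_pos_le[of s p "\<tau> i"] s le by (simp add: Homeo_plus_le_iff)
    then have "homeo_val s (pos_word (i # p)) (\<tau> i) < \<tau> i"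
      using moved[of i] by simp
    ultimately show ?thesis by (metis less_irrefl)
  qed
  from assms(5-7) show ?thesis
  proof (induction p arbitrary: q)
    case Nil
    show ?case
    proof (cases q)
      case (Cons j q')
      have "homeo_val s (pos_word (j # q')) \<noteq> homeo_val s (pos_word [])" by (rule neq) simp
      with Cons Nil.prems(3) show ?thesis by metis
    qed simp
  next
    case (Cons i p)
    show ?case
    proof (cases q)
      case Nil
      have "homeo_val s (pos_word (i # p)) \<noteq> homeo_val s (pos_word [])" by (rule neq) simp
      with Nil Cons.prems(3) show ?thesis by metis
    next
      case (Cons j q')
      consider "i = j" | "i < j" | "j < i" by linarith
      then show ?thesis
      proof cases
        case 1
        have "s i (homeo_val s (pos_word p) x) = s i (homeo_val s (pos_word q') x)" for x
          using fun_cong[OF Cons.prems(3), of x] 1 Cons by simp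
        then have "homeo_val s (pos_word p) = homeo_val s (pos_word q')"
          using s by (auto simp: Homeo_plus_eq_iff)
        with Cons.IH[of q'] Cons.prems 1 Cons show ?thesis by simp
      next
        case 2
        have "homeo_val s (pos_word (i # p)) \<noteq> homeo_val s (pos_word q)"
          by (rule neq) (use 2 Cons Cons.prems(2) in auto)
        with Cons.prems(3) show ?thesis by metis
      next
        case 3
        have "homeo_val s (pos_word q) \<noteq> homeo_val s (pos_word (i # p))"
          unfolding Cons by (rule neq) (use 3 Cons.prems(1) in auto)
        with Cons.prems(3) show ?thesis by metis
      qed
    qed
  qed
qed

theorem subgroup_generated_iso_thompson_F:
  fixes s :: "nat \<Rightarrow> real \<Rightarrow> real"
  assumes s: "\<And>i. s i \<in> carrier Homeo_plus"
    and rel: "\<And>i j. i < j \<Longrightarrow> s j \<circ> s i = s i \<circ> s (j + 1)"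
    and le: "\<And>i t. s i t \<le> t"
    and fixed: "\<And>i j. i < j \<Longrightarrow> s j (\<tau> i) = \<tau> i"
    and moved: "\<And>i. s i (\<tau> i) < \<tau> i"
  shows "subgroup_generated Homeo_plus (range s) \<cong> thompson_F"
proof -
  interpret group Homeo_plus by (rule group_Homeo_plus)
  have sound: "homeo_val s u = homeo_val s v" if "(u, v) \<in> pres_eq thompson_rel" for u v
  proof (rule word_val_pres_eq[OF s _ that])
    fix l r assume "(l, r) \<in> thompson_rel"
    then obtain i j where lr: "l = [(False, i), (True, j), (True, i)]" "r = [(True, j + 1)]" "i < j"
      by (auto simp: thompson_rel_def)
    have "finv (s i) (s j (s i x)) = s (j + 1) x" for x
      using fun_cong[OF rel[OF lr(3)], of x] s by (simp add: Homeo_plus_inv_eq)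
    then show "homeo_val s l = homeo_val s r"
      using s by (simp add: lr m_inv_Homeo_plus fun_eq_iff)
  qed
  have trivial: "u \<sim>\<^sub>F []" if u: "homeo_val s u = id" for u
  proof -
    obtain p q where pq: "u \<sim>\<^sub>F pos_word p @ neg_word q" using thompson_eq_pos_neg by blast
    have neg: "neg_word q = inverse_word (pos_word (rev q))"
      by (simp add: inverse_word_def rev_map comp_def)
    have pn: "pos_word (rev q) @ neg_word q \<sim>\<^sub>F []" "neg_word q @ pos_word (rev q) \<sim>\<^sub>F []"
      using append_inverse_word inverse_word_append unfolding neg thompson_eq_def by blast+
    have "homeo_val s (u @ pos_word (rev q)) = homeo_val s ((pos_word p @ neg_word q) @ pos_word (rev q))"
      using thompson_eq_context[OF pq, of "[]" "pos_word (rev q)"]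
      by (intro sound) (simp add: thompson_eq_def)
    also have "\<dots> = homeo_val s (pos_word p)"
      using thompson_eq_context[OF pn(2), of "pos_word p" "[]"]
      by (intro sound) (simp add: thompson_eq_def)
    finally have eq: "homeo_val s (pos_word p) = homeo_val s (pos_word (rev q))"
      using u s by (simp add: word_val_append)
    obtain p' q' where p': "sorted p'" "pos_word p \<sim>\<^sub>F pos_word p'" and q': "sorted q'" "pos_word (rev q) \<sim>\<^sub>F pos_word q'"
      using thompson_eq_sorted by metis
    have "homeo_val s (pos_word p') = homeo_val s (pos_word q')"
      using eq sound[OF p'(2)[unfolded thompson_eq_def]] sound[OF q'(2)[unfolded thompson_eq_def]]
      by simp
    then have "p' = q'"
      using p'(1) q'(1) s le fixed moved by (intro word_val_pos_inj[of s \<tau>])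
    with p'(2) have "pos_word p \<sim>\<^sub>F pos_word q'" by simp
    also have "pos_word q' \<sim>\<^sub>F pos_word (rev q)" using q'(2) by (rule thompson_eq_sym)
    finally have "pos_word p \<sim>\<^sub>F pos_word (rev q)" .
    then have "pos_word p @ neg_word q \<sim>\<^sub>F pos_word (rev q) @ neg_word q"
      using thompson_eq_context[of "pos_word p" "pos_word (rev q)" "[]" "neg_word q"] by simp
    from thompson_eq_trans[OF thompson_eq_trans[OF pq this] pn(1)] show ?thesis .
  qed
  have iff: "(u, v) \<in> pres_eq thompson_rel \<longleftrightarrow> homeo_val s u = homeo_val s v" for u v
  proof
    assume eq: "homeo_val s u = homeo_val s v"
    have "homeo_val s (u @ inverse_word v) = homeo_val s (v @ inverse_word v)"
      using s eq by (simp add: word_val_append)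
    also have "\<dots> = id"
      using sound[OF append_inverse_word] by simp
    finally have "u @ inverse_word v \<sim>\<^sub>F []" by (rule trivial)
    then have v: "u @ inverse_word v @ v \<sim>\<^sub>F v"
      using thompson_eq_context[of "u @ inverse_word v" "[]" "[]" v] by simp
    have "inverse_word v @ v \<sim>\<^sub>F []"
      unfolding thompson_eq_def by (rule inverse_word_append)
    then have "u \<sim>\<^sub>F u @ inverse_word v @ v"
      using thompson_eq_context[of "inverse_word v @ v" "[]" u "[]"] thompson_eq_sym by simp
    also note v
    finally have "u \<sim>\<^sub>F v" .
    then show "(u, v) \<in> pres_eq thompson_rel" by (simp add: thompson_eq_def)
  qed (rule sound)
  show ?thesis
    unfolding thompson_F_def thompson_rel_def[symmetric]
    by (rule subgroup_generated_iso_presented_group[OF s iff])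
qed

text \<open>With \<open>h = g \<circ> f\<close>, the generators of Thompson's group are
  \<open>x\<^sub>0 = h\<inverse>\<close> and \<open>x\<^sub>k\<^sub>+\<^sub>1 = h\<^sup>k g\<inverse> h\<^sup>-\<^sup>k\<close>; below, \<open>y k\<close> is the inverse of \<open>x\<^sub>k\<close>.\<close>

theorem fast_pair_iso_thompson_F:
  assumes f: "f \<in> carrier Homeo_plus" and g: "g \<in> carrier Homeo_plus"
    and f_ge: "\<And>x. x \<le> f x" and g_ge: "\<And>x. x \<le> g x"
    and f_fix: "\<And>x. b \<le> x \<Longrightarrow> f x = x" and g_fix: "\<And>x. x \<le> a \<Longrightarrow> g x = x"
    and "a < g (f a)" "b \<le> g (f a)" "g (f a) < g (g (f a))"
  shows "subgroup_generated Homeo_plus {f, g} \<cong> thompson_F"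
proof -
  interpret group Homeo_plus by (rule group_Homeo_plus)
  define h where "h = g \<circ> f"
  have h: "h \<in> carrier Homeo_plus" unfolding h_def by (intro comp_Homeo_plus f g)
  have h_ge: "x \<le> h x" for x unfolding h_def using f_ge g_ge order_trans by fastforce
  define y where "y n = (case n of 0 \<Rightarrow> h | Suc k \<Rightarrow> (h ^^ k) \<circ> g \<circ> (finv h ^^ k))" for n
  have y0: "y 0 = h" and y1: "y (Suc 0) = g" by (simp_all add: y_def fun_eq_iff)
  have y: "y n \<in> carrier Homeo_plus" for n
    unfolding y_def using f g h
    by (auto split: nat.split intro!: comp_Homeo_plus funpow_Homeo_plus inv_in_Homeo_plus)
  have y_h: "y (Suc (Suc k)) (h x) = h (y (Suc k) x)" for k x
    using h by (simp add: y_def funpow_swap1 Homeo_plus_inv_f_f)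
  have y_pow: "y (Suc k) ((h ^^ k) x) = (h ^^ k) (g x)" for k x
    by (induction k) (simp_all add: y1 y_h)
  have y_ge: "x \<le> y n x" for n x
  proof (cases n)
    case (Suc k)
    obtain z where "x = (h ^^ k) z"
      using Homeo_plus_obtain_preimage[OF funpow_Homeo_plus[OF h]] .
    then show ?thesis
      using g_ge[of z] Homeo_plus_le_iff[OF funpow_Homeo_plus[OF h]] by (simp add: Suc y_pow)
  qed (simp add: y0 h_ge)
  have y_fix: "y (Suc k) x = x" if "x \<le> (h ^^ k) a" for k x
  proof -
    obtain z where z: "x = (h ^^ k) z"
      using Homeo_plus_obtain_preimage[OF funpow_Homeo_plus[OF h]] .
    with that have "z \<le> a" using Homeo_plus_le_iff[OF funpow_Homeo_plus[OF h]] by simp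
    then show ?thesis by (simp add: z y_pow g_fix)
  qed
  have f_y: "f (y (Suc (Suc k)) x) = y (Suc (Suc k)) (f x)" for k x
  proof (rule commute_disjoint[OF f y f_fix])
    have "h a \<le> (h ^^ k) (h a)" by (rule funpow_ge[OF h_ge])
    then have "b \<le> (h ^^ Suc k) a" using assms(8) by (simp add: funpow_swap1 h_def)
    then show "y (Suc (Suc k)) x = x" if "x \<le> b" for x using that by (intro y_fix) simp
  qed
  have y_rel: "y i (y j x) = y (Suc j) (y i x)" if ij: "i < j" for i j x
  proof -
    have main: "y (Suc i) (y (Suc (Suc (i + m))) x) = y (Suc (Suc (Suc (i + m)))) (y (Suc i) x)"
      for i m x
    proof (induction i arbitrary: x)
      case 0
      obtain z where z: "x = f z" using Homeo_plus_obtain_preimage[OF f] .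
      have "g (y (Suc (Suc m)) (f z)) = h (y (Suc (Suc m)) z)"
        by (simp add: h_def flip: f_y)
      also have "\<dots> = y (Suc (Suc (Suc m))) (h z)" by (simp add: y_h)
      finally show ?case by (simp add: z y1 h_def)
    next
      case (Suc i)
      obtain z where z: "x = h z" using Homeo_plus_obtain_preimage[OF h] .
      show ?case using Suc.IH[of z] by (simp add: z y_h)
    qed
    obtain k where j: "j = Suc k" using ij by (cases j) auto
    show ?thesis
    proof (cases i)
      case 0
      then show ?thesis by (simp add: y0 y_h j)
    next
      case (Suc i')
      then obtain m where "k = Suc (i' + m)" using ij j by (auto dest: less_imp_Suc_add)
      then show ?thesis using main[of i' m x] by (simp add: j Suc)
    qed
  qed
  define s where "s n = finv (y n)" for n
  define \<tau> where "\<tau> i = (h ^^ i) a" for i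
  have s: "s n \<in> carrier Homeo_plus" for n
    unfolding s_def by (rule inv_in_Homeo_plus[OF y])
  have s_eq: "s n x = z \<longleftrightarrow> x = y n z" for n x z
    unfolding s_def by (rule Homeo_plus_inv_eq[OF y])
  have s_y: "s n (y n x) = x" for n x by (simp add: s_eq)
  have rel: "s j \<circ> s i = s i \<circ> s (j + 1)" if "i < j" for i j
  proof
    fix x
    obtain w where w: "x = y i (y j w)" using s_eq by metis
    have "(s j \<circ> s i) x = w" by (simp add: w s_y)
    moreover have "(s i \<circ> s (j + 1)) x = w" by (simp add: w y_rel[OF that] s_y)
    ultimately show "(s j \<circ> s i) x = (s i \<circ> s (j + 1)) x" by simp
  qed
  have le: "s n x \<le> x" for n x
    using y_ge[of "s n x" n] s_eq by metis
  have fixed: "s j (\<tau> i) = \<tau> i" if "i < j" for i j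
  proof -
    obtain k where k: "j = Suc (i + k)" using \<open>i < j\<close> by (auto dest: less_imp_Suc_add)
    have "(h ^^ i) a \<le> (h ^^ (i + k)) a"
      using funpow_ge[OF h_ge, of "(h ^^ i) a" k] by (simp add: funpow_add add.commute[of i])
    then show ?thesis unfolding s_eq \<tau>_def k by (simp add: y_fix)
  qed
  have moved: "s i (\<tau> i) < \<tau> i" for i
  proof -
    have "\<tau> i < y i (\<tau> i)"
    proof (cases i)
      case 0
      then show ?thesis using assms(7) by (simp add: y0 \<tau>_def h_def)
    next
      case (Suc k)
      have "h a < g (h a)" using assms(9) by (simp add: h_def)
      then have "(h ^^ k) (h a) < (h ^^ k) (g (h a))"
        using Homeo_plus_less_iff[OF funpow_Homeo_plus[OF h]] by simp
      then show ?thesis using y_pow[of k "h a"] by (simp add: Suc \<tau>_def funpow_swap1)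
    qed
    then show ?thesis
      using Homeo_plus_less_iff[OF s, of i "\<tau> i" "y i (\<tau> i)"] by (simp add: s_y)
  qed
  have "subgroup_generated Homeo_plus {f, g} = subgroup_generated Homeo_plus (range s)"
  proof (rule subgroup_generated_eqI)
    show fg: "{f, g} \<subseteq> carrier Homeo_plus" using f g by simp
    show ran: "range s \<subseteq> carrier Homeo_plus" using s by blast
    let ?K = "generate Homeo_plus {f, g}"
    have K: "subgroup ?K Homeo_plus" by (rule generate_is_subgroup[OF fg])
    have "f \<in> ?K" "g \<in> ?K" by (auto intro: generate.incl)
    then have "h \<in> ?K" unfolding h_def by (intro subgroup_Homeo_plus_comp[OF K])
    with \<open>g \<in> ?K\<close> have "y n \<in> ?K" for n
      unfolding y_def
      by (auto split: nat.split intro!: subgroup_Homeo_plus_comp[OF K]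
          subgroup_Homeo_plus_funpow[OF K] subgroup_Homeo_plus_inv[OF K])
    then show "range s \<subseteq> ?K"
      unfolding s_def by (auto intro: subgroup_Homeo_plus_inv[OF K])
    let ?L = "generate Homeo_plus (range s)"
    have L: "subgroup ?L Homeo_plus" by (rule generate_is_subgroup[OF ran])
    have s_L: "s n \<in> ?L" for n by (auto intro: generate.incl)
    have "finv (s n) = y n" for n
      using Homeo_plus_inv_eq[OF s] s_y by (metis ext)
    then have "y n \<in> ?L" for n
      using subgroup_Homeo_plus_inv[OF L s_L, of n] by simp
    from this[of 0] this[of 1] have "h \<in> ?L" "g \<in> ?L" by (simp_all add: y0 y1)
    moreover have "f = finv g \<circ> h"
      by (simp add: fun_eq_iff h_def Homeo_plus_inv_f_f[OF g])
    ultimately have "f \<in> ?L"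
      using subgroup_Homeo_plus_comp[OF L] subgroup_Homeo_plus_inv[OF L] by metis
    with \<open>g \<in> ?L\<close> show "{f, g} \<subseteq> ?L" by simp
  qed
  then show ?thesis
    using subgroup_generated_iso_thompson_F[of s \<tau>, OF s rel le fixed moved] by simp
qed

section \<open>Splitting the last generator\<close>

lemma conjugate_on_subset_iso:
  fixes s t :: "'a \<Rightarrow> real \<Rightarrow> real"
  assumes s: "\<And>i. s i \<in> carrier Homeo_plus" and t: "\<And>i. t i \<in> carrier Homeo_plus"
    and \<phi>: "inj_on \<phi> D" "\<phi> ` D = E"
    and conj: "\<And>i x. x \<in> D \<Longrightarrow> \<phi> (t i x) = s i (\<phi> x)"
    and s_fix: "\<And>i x. x \<notin> E \<Longrightarrow> s i x = x" and t_fix: "\<And>i x. x \<notin> D \<Longrightarrow> t i x = x"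
  shows "subgroup_generated Homeo_plus (range t) \<cong> subgroup_generated Homeo_plus (range s)"
proof -
  interpret group Homeo_plus by (rule group_Homeo_plus)
  have D: "t i x \<in> D \<longleftrightarrow> x \<in> D" for i x
    using Homeo_plus_eq_iff[OF t, of i "t i x" x] t_fix by metis
  have inv_D: "finv (t i) x \<in> D \<longleftrightarrow> x \<in> D" for i x
    using D[of i "finv (t i) x"] Homeo_plus_f_inv_f[OF t] by simp
  have eval_D: "homeo_val t u x \<in> D \<and> \<phi> (homeo_val t u x) = homeo_val s u (\<phi> x)" if "x \<in> D" for u x
  proof (induction u)
    case Nil
    show ?case using that by simp
  next
    case (Cons l u)
    obtain b i where l: "l = (b, i)" by (cases l)
    show ?case
    proof (cases b)
      case True
      with Cons show ?thesis by (simp add: l D conj)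
    next
      case False
      define z where "z = finv (t i) (homeo_val t u x)"
      have z: "z \<in> D" "homeo_val t u x = t i z"
        using Cons by (simp_all add: z_def inv_D Homeo_plus_f_inv_f[OF t])
      have "finv (s i) (homeo_val s u (\<phi> x)) = \<phi> z"
        using Cons conj[OF z(1), of i] z(2) by (simp add: Homeo_plus_inv_eq[OF s])
      with False z(1) show ?thesis
        by (simp add: l m_inv_Homeo_plus s t flip: z_def)
    qed
  qed
  have eval_t_fix: "homeo_val t u x = x" if "x \<notin> D" for u x
    using that by (induction u) (auto simp: m_inv_Homeo_plus t Homeo_plus_inv_eq t_fix)
  have eval_s_fix: "homeo_val s u x = x" if "x \<notin> E" for u x
    using that by (induction u) (auto simp: m_inv_Homeo_plus s Homeo_plus_inv_eq s_fix)
  have "homeo_val t u = homeo_val t v \<longleftrightarrow> homeo_val s u = homeo_val s v" for u v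
  proof
    assume eq: "homeo_val t u = homeo_val t v"
    show "homeo_val s u = homeo_val s v"
    proof
      fix z
      show "homeo_val s u z = homeo_val s v z"
      proof (cases "z \<in> E")
        case True
        then obtain x where "x \<in> D" "z = \<phi> x" using \<phi>(2) by blast
        then show ?thesis using eval_D[of x u] eval_D[of x v] eq by simp
      qed (simp add: eval_s_fix)
    qed
  next
    assume eq: "homeo_val s u = homeo_val s v"
    show "homeo_val t u = homeo_val t v"
    proof
      fix x
      show "homeo_val t u x = homeo_val t v x"
      proof (cases "x \<in> D")
        case True
        then show ?thesis
          using eval_D[of x u] eval_D[of x v] eq inj_onD[OF \<phi>(1)] by simp
      qed (simp add: eval_t_fix)
    qed
  qed
  then show ?thesis by (intro subgroup_generated_iso t s)
qed

text \<open>The homeomorphism \<open>g\<close> may be modified far to the right of the support of \<open>f\<close> without changing, up to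
  isomorphism, the group generated by the pair: \<open>\<phi> = lim g\<^sup>n \<circ> v\<^sup>-\<^sup>n\<close>, an eventually constant limit, conjugates
  \<open>v\<close> to \<open>g\<close> and commutes with \<open>f\<close>.\<close>

lemma agree_left_iso:
  assumes f: "f \<in> carrier Homeo_plus" and g: "g \<in> carrier Homeo_plus" and v: "v \<in> carrier Homeo_plus"
    and v_ge: "\<And>x. x \<le> v x" and g_ge: "\<And>x. x \<le> g x"
    and f_fix: "\<And>x. b \<le> x \<Longrightarrow> f x = x" and "b \<le> c"
    and vg: "\<And>x. x \<le> c \<Longrightarrow> v x = g x"
    and v_gt: "\<And>x. c \<le> x \<Longrightarrow> x < d \<Longrightarrow> x < v x" and v_fix: "\<And>x. d \<le> x \<Longrightarrow> v x = x" and "c < d"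
    and E: "c \<in> E" "\<And>x y. x \<le> y \<Longrightarrow> y \<in> E \<Longrightarrow> x \<in> E"
    and g_gt: "\<And>x. c \<le> x \<Longrightarrow> x \<in> E \<Longrightarrow> x < g x" and g_fix: "\<And>x. x \<notin> E \<Longrightarrow> g x = x"
  shows "subgroup_generated Homeo_plus {f, v} \<cong> subgroup_generated Homeo_plus {f, g}"
proof -
  let ?v = "\<lambda>n. finv v ^^ n"
  have pow: "(g ^^ n) \<in> carrier Homeo_plus" "(v ^^ n) \<in> carrier Homeo_plus"
      "?v n \<in> carrier Homeo_plus" for n
    using g v by (auto intro: funpow_Homeo_plus inv_in_Homeo_plus)
  have v_pow: "?v n ((v ^^ n) x) = x" for n x
    by (induction n arbitrary: x) (simp_all add: funpow_swap1 Homeo_plus_inv_f_f[OF v])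
  have inv_le: "finv v x \<le> x" for x
    using v_ge[of "finv v x"] Homeo_plus_f_inv_f[OF v] by simp
  have stable: "?v (m + n) x \<le> c \<and> (g ^^ (m + n)) (?v (m + n) x) = (g ^^ n) (?v n x)"
    if "?v n x \<le> c" for m n x
  proof (induction m)
    case 0
    show ?case using that by simp
  next
    case (Suc m)
    let ?z = "?v (m + n) x"
    have le: "finv v ?z \<le> c" using Suc inv_le[of ?z] by simp
    then have "g (finv v ?z) = ?z" using vg Homeo_plus_f_inv_f[OF v] by metis
    with le Suc show ?case by (simp add: funpow_swap1)
  qed
  have ex: "\<exists>n. ?v n x \<le> c" if "x < d" for x
  proof -
    have "\<exists>n. x \<le> (v ^^ n) c" using that by (intro funpow_exceeds v v_gt) auto
    then obtain n where "x \<le> (v ^^ n) c" by blast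
    then have "?v n x \<le> ?v n ((v ^^ n) c)" using Homeo_plus_le_iff[OF pow(3)] by blast
    then show ?thesis by (auto simp: v_pow)
  qed
  define \<phi> where "\<phi> x = (let n = LEAST n. ?v n x \<le> c in (g ^^ n) (?v n x))" for x
  have \<phi>: "\<phi> x = (g ^^ n) (?v n x)" if n: "?v n x \<le> c" for x n
  proof -
    let ?k = "LEAST n. ?v n x \<le> c"
    have "?v ?k x \<le> c" "?k \<le> n" using n by (rule LeastI, rule Least_le)
    then show ?thesis using stable[of ?k x "n - ?k"] by (simp add: \<phi>_def Let_def)
  qed
  have \<phi>_id: "\<phi> x = x" if "x \<le> c" for x using \<phi>[of 0 x] that by simp
  have \<phi>_less: "\<phi> x < \<phi> y" if "x < y" "y < d" for x y
  proof -
    obtain n where n: "?v n y \<le> c" using ex[OF \<open>y < d\<close>] by blast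
    moreover have lt: "?v n x < ?v n y" using that Homeo_plus_less_iff[OF pow(3)] by blast
    ultimately show ?thesis
      using \<phi>[of n x] \<phi>[of n y] Homeo_plus_less_iff[OF pow(1)] by simp
  qed
  have \<phi>_v: "\<phi> (v x) = g (\<phi> x)" if "x < d" for x
  proof -
    obtain n where n: "?v n x \<le> c" using ex \<open>x < d\<close> by blast
    moreover have "?v (Suc n) (v x) = ?v n x"
      by (simp add: funpow_swap1 Homeo_plus_inv_f_f[OF v])
    ultimately show ?thesis using \<phi>[of n x] \<phi>[of "Suc n" "v x"] by simp
  qed
  have \<phi>_f: "\<phi> (f x) = f (\<phi> x)" if "x < d" for x
  proof (cases "x \<le> b")
    case True
    then have "f x \<le> b" using Homeo_plus_le_iff[OF f, of x b] f_fix[of b] by simp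
    with True \<open>b \<le> c\<close> show ?thesis by (simp add: \<phi>_id)
  next
    case False
    then have "b < \<phi> x" using \<phi>_less[of b x] \<phi>_id[of b] \<open>x < d\<close> \<open>b \<le> c\<close> by simp
    with False show ?thesis by (simp add: f_fix)
  qed
  have g_E: "(g ^^ n) x \<in> E \<longleftrightarrow> x \<in> E" for n x
  proof (induction n)
    case (Suc n)
    have "g z \<in> E \<longleftrightarrow> z \<in> E" for z
      using Homeo_plus_eq_iff[OF g, of "g z" z] g_fix g_ge E(2) by metis
    with Suc show ?case by simp
  qed simp
  have image: "\<phi> ` {..<d} = E"
  proof (intro equalityI subsetI)
    fix z assume "z \<in> \<phi> ` {..<d}"
    then obtain x where x: "x < d" "z = \<phi> x" by auto
    obtain n where n: "?v n x \<le> c" using ex x(1) by blast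
    with E have "?v n x \<in> E" by blast
    with x(2) n show "z \<in> E" by (simp add: \<phi> g_E)
  next
    fix z assume "z \<in> E"
    then have "\<exists>n. z \<le> (g ^^ n) c"
      using E(2) by (intro funpow_exceeds g g_gt) auto
    then obtain n where n: "z \<le> (g ^^ n) c" by blast
    obtain w where w: "z = (g ^^ n) w" using Homeo_plus_obtain_preimage[OF pow(1)] .
    with n have "w \<le> c" using Homeo_plus_le_iff[OF pow(1)] by simp
    have "(v ^^ n) d = d" by (induction n) (simp_all add: v_fix)
    then have "(v ^^ n) w < d"
      using \<open>w \<le> c\<close> \<open>c < d\<close> Homeo_plus_less_iff[OF pow(2), of n w d] by simp
    moreover have "\<phi> ((v ^^ n) w) = z"
      using \<phi>[of n "(v ^^ n) w"] \<open>w \<le> c\<close> by (simp add: v_pow w)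
    ultimately show "z \<in> \<phi> ` {..<d}" by force
  qed
  let ?s = "\<lambda>i. if i then f else g" and ?t = "\<lambda>i. if i then f else v"
  have "b \<in> E" using E \<open>b \<le> c\<close> by blast
  then have f_fix_E: "f x = x" if "x \<notin> E" for x
    using that E(2) f_fix[of x] by (metis linear)
  have "subgroup_generated Homeo_plus (range ?t) \<cong> subgroup_generated Homeo_plus (range ?s)"
  proof (rule conjugate_on_subset_iso[where D = "{..<d}" and E = E and \<phi> = \<phi>])
    show "inj_on \<phi> {..<d}"
      using \<phi>_less by (intro linorder_inj_onI) (auto simp: less_imp_neq)
  qed (use f g v image \<phi>_v \<phi>_f f_fix_E g_fix f_fix v_fix \<open>b \<le> c\<close> \<open>c < d\<close> in auto)
  moreover have "range ?t = {f, v}" "range ?s = {f, g}" by auto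
  ultimately show ?thesis by simp
qed

lemma generate_pair_split:
  assumes f: "f \<in> carrier Homeo_plus" and g: "g \<in> carrier Homeo_plus"
    and f_ge: "\<And>x. x \<le> f x" and g_ge: "\<And>x. x \<le> g x"
    and f_fix: "\<And>x. b \<le> x \<Longrightarrow> f x = x" and f_gt: "\<And>x. a \<le> x \<Longrightarrow> x < b \<Longrightarrow> x < f x"
    and supp_g: "supp g = {a<..} \<inter> E" and E: "b \<in> E" "\<And>x y. x \<le> y \<Longrightarrow> y \<in> E \<Longrightarrow> x \<in> E"
    and "a < b"
  obtains v w c d where
    "v \<in> carrier Homeo_plus" "w \<in> carrier Homeo_plus"
    "\<And>x. x \<le> v x" "\<And>x. x \<le> w x"
    "supp v = {a<..<d}" "supp w = {c<..} \<inter> E" "b \<le> c" "c < d" "d \<in> E"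
    "v \<circ> w = g"
    "v \<in> generate Homeo_plus {f, g}" "w \<in> generate Homeo_plus {f, g}"
    "subgroup_generated Homeo_plus {f, v} \<cong> subgroup_generated Homeo_plus {f, g}"
    "subgroup_generated Homeo_plus {v, w} \<cong> thompson_F"
proof -
  have g_iff: "g x \<noteq> x \<longleftrightarrow> a < x \<and> x \<in> E" for x
    using arg_cong[OF supp_g, of "\<lambda>S. x \<in> S"] by (simp add: supp_def)
  then have g_fix: "g x = x" if "x \<le> a \<or> x \<notin> E" for x
    using that not_le by blast
  have g_gt: "x < g x" if "a < x" "x \<in> E" for x
    using g_iff[of x] g_ge[of x] that by simp
  have g_E: "g x \<in> E \<longleftrightarrow> x \<in> E" for x
    using Homeo_plus_eq_iff[OF g, of "g x" x] g_fix g_ge E(2) by metis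
  obtain k where k: "finv g b \<le> (f ^^ k) a"
  proof -
    have "finv g b < b"
      using g_gt[OF \<open>a < b\<close> E(1)] Homeo_plus_less_iff[OF g, of "finv g b" b]
      by (simp add: Homeo_plus_f_inv_f[OF g])
    then have "\<exists>k. finv g b \<le> (f ^^ k) a"
      by (intro funpow_exceeds f f_gt) auto
    then show ?thesis using that by blast
  qed
  define F where "F = f ^^ k"
  have F: "F \<in> carrier Homeo_plus" unfolding F_def by (rule funpow_Homeo_plus[OF f])
  have F_fix: "F x = x" if "b \<le> x" for x
    unfolding F_def by (induction k) (simp_all add: f_fix that)
  have F_ge: "x \<le> F x" for x unfolding F_def by (rule funpow_ge[OF f_ge])
  have F_lt: "F x < b" if "x < b" for x
    using Homeo_plus_less_iff[OF F, of x b] F_fix[of b] that by simp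
  have gF: "b \<le> g (F a)"
    using k Homeo_plus_le_iff[OF g, of "finv g b" "F a"]
    by (simp add: F_def Homeo_plus_f_inv_f[OF g])
  have F_E: "F x \<in> E \<longleftrightarrow> x \<in> E" for x
    using F_fix F_lt E by (metis linear not_le less_imp_le)
  define h where "h = g \<circ> F"
  have h: "h \<in> carrier Homeo_plus" unfolding h_def by (intro comp_Homeo_plus g F)
  have h_E: "h x \<in> E \<longleftrightarrow> x \<in> E" for x by (simp add: h_def g_E F_E)
  define w where "w = h \<circ> g \<circ> finv h"
  define v where "v = g \<circ> finv w"
  define c where "c = h a"
  define d where "d = g (g b)"
  have w: "w \<in> carrier Homeo_plus"
    unfolding w_def by (intro comp_Homeo_plus h g inv_in_Homeo_plus)
  have v: "v \<in> carrier Homeo_plus"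
    unfolding v_def by (intro comp_Homeo_plus g inv_in_Homeo_plus w)
  have w_h: "w (h x) = h (g x)" for x by (simp add: w_def Homeo_plus_inv_f_f[OF h])
  have v_w: "v (w x) = g x" for x by (simp add: v_def Homeo_plus_inv_f_f[OF w])
  have w_ge: "x \<le> w x" for x
  proof -
    obtain z where "x = h z" using Homeo_plus_obtain_preimage[OF h] .
    then show ?thesis using g_ge[of z] Homeo_plus_le_iff[OF h] by (simp add: w_h)
  qed
  have w_eq_iff: "w x = x \<longleftrightarrow> x \<le> c \<or> x \<notin> E" for x
  proof -
    obtain z where z: "x = h z" using Homeo_plus_obtain_preimage[OF h] .
    have "w x = x \<longleftrightarrow> g z = z" by (simp add: z w_h Homeo_plus_eq_iff[OF h])
    also have "\<dots> \<longleftrightarrow> z \<le> a \<or> z \<notin> E" using g_fix g_gt by force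
    finally show ?thesis by (simp add: z c_def h_E Homeo_plus_le_iff[OF h])
  qed
  have bc: "b \<le> c" using gF by (simp add: c_def h_def)
  have "c < g b"
    using F_lt[OF \<open>a < b\<close>] Homeo_plus_less_iff[OF g] by (simp add: c_def h_def)
  then have cd: "c < d" using g_ge[of "g b"] by (simp add: d_def)
  have dE: "d \<in> E" using E(1) by (simp add: d_def g_E)
  have cE: "c \<in> E" using E(2) cd dE by (meson less_imp_le)
  have key: "F (g z) < g (F z)" if z: "z < b" "a < g (F z)" for z
  proof (cases "z \<le> a")
    case True
    have "a < F z"
      using z(2) Homeo_plus_less_iff[OF g, of a "F z"] g_fix[of a] by simp
    moreover have "F z \<in> E" using F_lt[OF z(1)] E by (meson less_imp_le)
    ultimately have "F z < g (F z)" by (rule g_gt)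
    with True show ?thesis by (simp add: g_fix)
  next
    case False
    show ?thesis
    proof (cases "g z < b")
      case True
      have "F a < F z" using False Homeo_plus_less_iff[OF F] by simp
      then have "b < g (F z)"
        using gF Homeo_plus_less_iff[OF g, of "F a" "F z"] by simp
      with F_lt[OF True] show ?thesis by simp
    next
      case False': False
      have "a < z" using False by simp
      then have "k \<noteq> 0"
        using gF g_fix[of a] \<open>a < b\<close> by (cases k) (auto simp: F_def)
      then obtain j where "k = Suc j" by (cases k) auto
      then have "F z = (f ^^ j) (f z)" by (simp add: F_def funpow_swap1)
      then have "f z \<le> F z" using funpow_ge[OF f_ge, of "f z" j] by simp
      then have "z < F z" using f_gt[of z] \<open>a < z\<close> z(1) by simp
      then have "g z < g (F z)" using Homeo_plus_less_iff[OF g] by simp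
      with False' show ?thesis by (simp add: F_fix)
    qed
  qed
  have hb: "h b = g b" and hgb: "h (g b) = d"
    using F_fix g_ge[of b] by (simp_all add: h_def d_def)
  have v_cases: "(a < x \<and> x < d \<longrightarrow> x < v x) \<and> (\<not> (a < x \<and> x < d) \<longrightarrow> v x = x)" for x
  proof -
    obtain y where y: "x = w y" using Homeo_plus_obtain_preimage[OF w] .
    obtain z where z: "y = h z" using Homeo_plus_obtain_preimage[OF h] .
    have x: "x = h (g z)" by (simp add: y z w_h)
    have vx: "v x = g y" by (simp add: y v_w)
    have "w a = a" using w_eq_iff \<open>a < b\<close> bc by simp
    then have ax: "a < x \<longleftrightarrow> a < y" using Homeo_plus_less_iff[OF w, of a y] by (simp add: y)
    have xd: "x < d \<longleftrightarrow> z < b"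
      using Homeo_plus_less_iff[OF h, of "g z" "g b"] Homeo_plus_less_iff[OF g, of z b]
      by (simp add: x hgb)
    have "x < v x" if "a < x" "x < d"
    proof -
      have "F (g z) < g (F z)"
        using that ax xd z by (intro key) (simp_all add: h_def)
      then have "g (F (g z)) < g (g (F z))" using Homeo_plus_less_iff[OF g] by simp
      then show ?thesis using vx x z by (simp add: h_def)
    qed
    moreover have "v x = x" if "x \<le> a"
    proof -
      have "y \<le> a" using that ax by simp
      then have "w y = y" using w_eq_iff \<open>a < b\<close> bc by simp
      with \<open>y \<le> a\<close> show ?thesis using vx y by (simp add: g_fix)
    qed
    moreover have "v x = x" if "d \<le> x"
    proof -
      have "b \<le> z" using that xd by simp
      moreover from this have "b \<le> g z" using g_ge[of z] by simp
      ultimately show ?thesis using vx x z by (simp add: h_def F_fix)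
    qed
    ultimately show ?thesis by auto
  qed
  have v_ge: "x \<le> v x" for x using v_cases[of x] by (cases "a < x \<and> x < d") auto
  have "v x \<noteq> x \<longleftrightarrow> a < x \<and> x < d" for x using v_cases[of x] by auto
  then have supp_v: "supp v = {a<..<d}" by (simp add: supp_def set_eq_iff)
  have supp_w: "supp w = {c<..} \<inter> E" by (auto simp: supp_def w_eq_iff)
  have vw: "v \<circ> w = g" by (simp add: fun_eq_iff v_w)
  have v_g: "v x = g x" if "x \<le> c" for x
    using v_w[of x] w_eq_iff[of x] that by simp
  let ?K = "generate Homeo_plus {f, g}"
  have K: "subgroup ?K Homeo_plus"
    using f g by (intro group.generate_is_subgroup group_Homeo_plus) simp
  have fg: "f \<in> ?K" "g \<in> ?K" by (auto intro: generate.incl)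
  have "h \<in> ?K"
    unfolding h_def F_def
    by (intro subgroup_Homeo_plus_comp[OF K] subgroup_Homeo_plus_funpow[OF K] fg)
  then have wK: "w \<in> ?K"
    unfolding w_def by (intro subgroup_Homeo_plus_comp[OF K] subgroup_Homeo_plus_inv[OF K] fg)
  then have vK: "v \<in> ?K"
    unfolding v_def by (intro subgroup_Homeo_plus_comp[OF K] subgroup_Homeo_plus_inv[OF K] fg)
  have ac: "a < c" using \<open>a < b\<close> bc by simp
  have fv: "subgroup_generated Homeo_plus {f, v} \<cong> subgroup_generated Homeo_plus {f, g}"
  proof (rule agree_left_iso[OF f g v v_ge g_ge f_fix bc v_g _ _ cd cE E(2)])
    show "x < v x" if "c \<le> x" "x < d" for x using v_cases[of x] that ac by simp
    show "v x = x" if "d \<le> x" for x using v_cases[of x] that by simp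
    show "x < g x" if "c \<le> x" "x \<in> E" for x using g_gt[of x] that ac by simp
    show "g x = x" if "x \<notin> E" for x using g_fix that by simp
  qed
  have "w (v c) = w (g c)" by (simp add: v_g)
  moreover have "w (g b) \<le> w (g c)"
    using bc Homeo_plus_le_iff[OF w] Homeo_plus_le_iff[OF g] by simp
  moreover have "w (g b) = d" using w_h[of b] by (simp add: hb hgb)
  ultimately have dwv: "d \<le> w (v c)" by simp
  have "subgroup_generated Homeo_plus {v, w} \<cong> thompson_F"
  proof (rule fast_pair_iso_thompson_F[OF v w v_ge w_ge])
    show "v x = x" if "d \<le> x" for x using v_cases[of x] that by simp
    show "w x = x" if "x \<le> c" for x using w_eq_iff that by simp
    show "c < w (v c)" "d \<le> w (v c)" using dwv cd by simp_all
    have "w (v c) \<in> E"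
    proof -
      have w_E: "w x \<in> E \<longleftrightarrow> x \<in> E" for x
        using Homeo_plus_eq_iff[OF w, of "w x" x] w_eq_iff w_ge E(2) by metis
      show ?thesis using cE by (simp add: w_E v_g g_E)
    qed
    then show "w (v c) < w (w (v c))"
      using w_eq_iff[of "w (v c)"] w_ge[of "w (v c)"] dwv cd by (simp add: less_le)
  qed
  with v w v_ge w_ge supp_v supp_w bc cd dE vw vK wK fv show ?thesis by (rule that)
qed

lemma overlapping_intervals:
  assumes J: "open J" "is_interval J" and K: "open K" "is_interval K"
    and JK: "J \<inter> K \<noteq> {}" "J \<inter> K \<subset> K" and left: "left_endpoint J < left_endpoint K"
  obtains a b E where "K = {a<..} \<inter> E" "a < b" "b \<in> E"
    "\<And>x y. x \<le> y \<Longrightarrow> y \<in> E \<Longrightarrow> x \<in> E" "{a..<b} \<subseteq> J" "J \<subseteq> {..<b}"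
proof -
  obtain x where x: "x \<in> J" "ereal x < left_endpoint K"
    using left unfolding left_endpoint_def[of J] INF_less_iff by blast
  have xK: "x < t" if "t \<in> K" for t
    using less_INF_D[OF x(2)[unfolded left_endpoint_def] that] by simp
  obtain p where p: "p \<in> J" "p \<in> K" using JK(1) by blast
  obtain q where q: "q \<in> K" "q \<notin> J" using JK(2) by blast
  have convJ: "z \<in> J" if "s \<in> J" "t \<in> J" "s \<le> z" "z \<le> t" for s t z
    using mem_is_interval_1_I[OF J(2)] that by blast
  have convK: "z \<in> K" if "s \<in> K" "t \<in> K" "s \<le> z" "z \<le> t" for s t z
    using mem_is_interval_1_I[OF K(2)] that by blast
  have "p < q" using convJ[of x p q] x(1) p(1) q xK[OF q(1)] by fastforce
  have Jq: "y < q" if "y \<in> J" for y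
    using convJ[of p y q] p(1) q(2) that \<open>p < q\<close> by fastforce
  define a where "a = Inf K"
  define b where "b = Sup J"
  have bddK: "bdd_below K" using xK by (intro bdd_belowI[of _ x]) (auto intro: less_imp_le)
  have bddJ: "bdd_above J" using Jq by (intro bdd_aboveI[of _ q]) (auto intro: less_imp_le)
  have "a \<notin> K" unfolding a_def using K(1) xK by (intro Inf_notin_open[of K x]) auto
  have "b \<notin> J" unfolding b_def using J(1) Jq by (intro Sup_notin_open[of J q]) auto
  have a_less: "a < t" if "t \<in> K" for t
    using cInf_lower[OF that bddK] \<open>a \<notin> K\<close> that by (metis a_def less_le)
  have less_b: "t < b" if "t \<in> J" for t
    using cSup_upper[OF that bddJ] \<open>b \<notin> J\<close> that by (metis b_def less_le)
  have "b \<le> q" unfolding b_def using p(1) Jq by (intro cSup_least) (auto intro: less_imp_le)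
  then have "b \<in> K" using convK[OF p(2) q(1)] less_b[OF p(1)] by simp
  have "x \<le> a" unfolding a_def using p(2) xK by (intro cInf_greatest) (auto intro: less_imp_le)
  show thesis
  proof (rule that[of a "{z. \<exists>s\<in>K. z \<le> s}" b])
    show "K = {a<..} \<inter> {z. \<exists>s\<in>K. z \<le> s}"
    proof (intro equalityI subsetI)
      fix z assume "z \<in> {a<..} \<inter> {z. \<exists>s\<in>K. z \<le> s}"
      then obtain s where s: "s \<in> K" "z \<le> s" "a < z" by auto
      then obtain t where "t \<in> K" "t < z"
        using cInf_less_iff[OF _ bddK, of z] unfolding a_def by blast
      with s show "z \<in> K" using convK[of t s z] by simp
    qed (use a_less in auto)
    show "a < b" using a_less \<open>b \<in> K\<close> .
    show "b \<in> {z. \<exists>s\<in>K. z \<le> s}" using \<open>b \<in> K\<close> by auto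
    show "x \<in> {z. \<exists>s\<in>K. z \<le> s}" if "x \<le> y" "y \<in> {z. \<exists>s\<in>K. z \<le> s}" for x y
      using that order_trans by blast
    show "{a..<b} \<subseteq> J"
    proof
      fix z assume z: "z \<in> {a..<b}"
      then obtain y where "y \<in> J" "z < y"
        using less_cSup_iff[OF _ bddJ, of z] p(1) unfolding b_def by auto
      with z \<open>x \<le> a\<close> show "z \<in> J" using convJ[OF x(1), of y z] by simp
    qed
    show "J \<subseteq> {..<b}" using less_b by auto
  qed
qed

lemma chain_of_intervals_disjointD:
  assumes "chain_of_intervals n J" "1 \<le> i" "i + 1 < k" "k \<le> n"
  shows "J i \<inter> J k = {}"
proof -
  have "\<bar>int i - int k\<bar> > 1" using assms(3) by simp
  with assms show ?thesis unfolding chain_of_intervals_def by auto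
qed

lemma chain_group_Suc:
  assumes "chain_group n G"
  shows "chain_group (Suc n) G"
proof -
  obtain f where "2 \<le> n" and f: "\<And>i. i \<in> {1..n} \<Longrightarrow> f i \<in> carrier Homeo_plus"
    and chain: "chain_of_intervals n (\<lambda>i. supp (f i))"
    and left: "\<And>i. i \<in> {1..<n} \<Longrightarrow> left_endpoint (supp (f i)) < left_endpoint (supp (f (i + 1)))"
    and ge: "\<And>i t. i \<in> {1..n} \<Longrightarrow> t \<le> f i t"
    and iso: "\<And>i. i \<in> {1..<n} \<Longrightarrow> subgroup_generated Homeo_plus {f i, f (i + 1)} \<cong> thompson_F"
    and G: "G = subgroup_generated Homeo_plus (f ` {1..n})"
    using assms unfolding chain_group_def by blast
  obtain p where n: "n = Suc p" and p: "1 \<le> p"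
    using \<open>2 \<le> n\<close> by (cases n) auto
  have ivl: "supp (f i) \<noteq> {} \<and> open (supp (f i)) \<and> is_interval (supp (f i))" if "i \<in> {1..n}" for i
    using chain that unfolding chain_of_intervals_def by blast
  have overlap: "supp (f i) \<inter> supp (f (i + 1)) \<noteq> {} \<and>
      supp (f i) \<inter> supp (f (i + 1)) \<subset> supp (f i) \<and>
      supp (f i) \<inter> supp (f (i + 1)) \<subset> supp (f (i + 1))" if "i \<in> {1..<n}" for i
    using chain that unfolding chain_of_intervals_def by blast
  let ?J = "supp (f p)" and ?K = "supp (f n)"
  have pn: "p \<in> {1..n}" "n \<in> {1..n}" "p \<in> {1..<n}" "p + 1 = n" using p n by simp_all
  obtain a b E where K: "?K = {a<..} \<inter> E" and "a < b" and E: "b \<in> E"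
      "\<And>x y. x \<le> y \<Longrightarrow> y \<in> E \<Longrightarrow> x \<in> E" and J: "{a..<b} \<subseteq> ?J" "?J \<subseteq> {..<b}"
  proof (rule overlapping_intervals[of ?J ?K])
    show "open ?J" "is_interval ?J" "open ?K" "is_interval ?K"
      using ivl[OF pn(1)] ivl[OF pn(2)] by blast+
    show "?J \<inter> ?K \<noteq> {}" "?J \<inter> ?K \<subset> ?K" "left_endpoint ?J < left_endpoint ?K"
      using overlap[OF pn(3)] left[OF pn(3)] unfolding pn(4) by blast+
  qed (rule that; assumption)
  have f_fix: "f p x = x" if "b \<le> x" for x using J(2) that by (auto simp: supp_def)
  have f_gt: "x < f p x" if "a \<le> x" "x < b" for x
  proof -
    have "x \<in> ?J" using J(1) that by auto
    then show ?thesis using ge[OF pn(1), of x] by (simp add: supp_def)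
  qed
  obtain v w c d where v: "v \<in> carrier Homeo_plus" and w: "w \<in> carrier Homeo_plus"
    and v_ge: "\<And>x. x \<le> v x" and w_ge: "\<And>x. x \<le> w x"
    and supp_v: "supp v = {a<..<d}" and supp_w: "supp w = {c<..} \<inter> E"
    and cd: "b \<le> c" "c < d" "d \<in> E" and vw: "v \<circ> w = f n"
    and gen: "v \<in> generate Homeo_plus {f p, f n}" "w \<in> generate Homeo_plus {f p, f n}"
    and iso_fv: "subgroup_generated Homeo_plus {f p, v} \<cong> subgroup_generated Homeo_plus {f p, f n}"
    and iso_vw: "subgroup_generated Homeo_plus {v, w} \<cong> thompson_F"
  proof (rule generate_pair_split[OF f[OF pn(1)] f[OF pn(2)] ge[OF pn(1)] ge[OF pn(2)]])
    show "f p x = x" if "b \<le> x" for x using f_fix that .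
    show "x < f p x" if "a \<le> x" "x < b" for x using f_gt that .
    show "x \<in> E" if "x \<le> y" "y \<in> E" for x y using E(2) that .
  qed (rule K E(1) \<open>a < b\<close> that; assumption?)+
  have vK: "supp v \<subseteq> ?K"
    unfolding supp_v K using E(2)[OF less_imp_le cd(3)] by auto
  have wK: "supp w = ?K \<inter> {c<..}"
    unfolding supp_w K using \<open>a < b\<close> cd(1) by auto
  define F where "F i = (if i \<le> p then f i else if i = n then v else w)" for i
  have F_low: "F i = f i" if "i \<le> p" for i using that by (simp add: F_def)
  have F_n: "F n = v" "F (Suc p) = v" and F_Suc: "F (Suc n) = w" "F (Suc (Suc p)) = w"
    by (simp_all add: F_def n)
  have cases: thesis
    if "i \<in> {1..Suc n}" "1 \<le> i \<Longrightarrow> i \<le> p \<Longrightarrow> thesis" "i = n \<Longrightarrow> thesis" "i = Suc n \<Longrightarrow> thesis"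
    for i thesis
    using that n by (cases "i \<le> p"; cases "i = n") auto
  have step_cases: thesis
    if "i \<in> {1..<Suc n}" "i \<in> {1..<n} \<Longrightarrow> i + 1 \<le> p \<Longrightarrow> thesis" "i = p \<Longrightarrow> thesis" "i = n \<Longrightarrow> thesis"
    for i thesis
    using that n by (cases "i < p"; cases "i = n") auto
  have "chain_of_intervals (Suc n) (\<lambda>i. supp (F i))"
    unfolding chain_of_intervals_def
  proof (intro conjI ballI impI)
    fix i assume i: "i \<in> {1..Suc n}"
    have "supp (F i) \<noteq> {} \<and> open (supp (F i)) \<and> is_interval (supp (F i))"
      using i
    proof (rule cases)
      assume "1 \<le> i" "i \<le> p"
      then show ?thesis using ivl[of i] n by (simp add: F_low)
    next
      assume "i = n"
      have "b \<in> supp v" using \<open>a < b\<close> cd by (simp add: supp_v)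
      then show ?thesis unfolding \<open>i = n\<close> F_n supp_v by auto
    next
      assume "i = Suc n"
      have "d \<in> supp w" using cd by (simp add: supp_w)
      moreover have "open (supp w)" unfolding wK using ivl[OF pn(2)] by auto
      moreover have "is_interval (supp w)"
        unfolding wK using ivl[OF pn(2)] by (intro is_interval_Int) auto
      ultimately show ?thesis unfolding \<open>i = Suc n\<close> F_Suc by blast
    qed
    then show "supp (F i) \<noteq> {}" "open (supp (F i))" "is_interval (supp (F i))" by simp_all
  next
    have *: "supp (F i) \<inter> supp (F k) = {}" if i: "1 \<le> i" "i + 1 < k" and k: "k \<in> {1..Suc n}" for i k
      using k
    proof (rule cases)
      assume "k \<le> p"
      then show ?thesis
        using chain_of_intervals_disjointD[OF chain, of i k] i n by (simp add: F_low)
    next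
      assume "k = n"
      then have "supp (f i) \<inter> ?K = {}" "i \<le> p"
        using chain_of_intervals_disjointD[OF chain, of i k] i n by simp_all
      then show ?thesis using vK \<open>k = n\<close> by (auto simp: F_low F_n)
    next
      assume "k = Suc n"
      show ?thesis
      proof (cases "i = p")
        case True
        then show ?thesis using J(2) cd(1) \<open>k = Suc n\<close> by (force simp: F_low F_Suc wK)
      next
        case False
        then have "supp (f i) \<inter> ?K = {}" "i \<le> p"
          using chain_of_intervals_disjointD[OF chain, of i n] i n \<open>k = Suc n\<close> by simp_all
        then show ?thesis using \<open>k = Suc n\<close> by (auto simp: F_low F_Suc wK)
      qed
    qed
    fix i k assume "i \<in> {1..Suc n}" "k \<in> {1..Suc n}" "1 < \<bar>int i - int k\<bar>"
    then show "supp (F i) \<inter> supp (F k) = {}"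
      using *[of i k] *[of k i] by (cases "i < k") (auto simp: Int_commute)
  next
    fix i assume i: "i \<in> {1..<Suc n}"
    have "supp (F i) \<inter> supp (F (i + 1)) \<noteq> {} \<and>
      supp (F i) \<inter> supp (F (i + 1)) \<subset> supp (F i) \<and>
      supp (F i) \<inter> supp (F (i + 1)) \<subset> supp (F (i + 1))"
      using i
    proof (rule step_cases)
      assume "i \<in> {1..<n}" "i + 1 \<le> p"
      then show ?thesis using overlap[of i] by (simp add: F_low)
    next
      assume "i = p"
      obtain z where "a < z" "z < b" using dense[OF \<open>a < b\<close>] by blast
      then have "z \<in> ?J" "z \<in> supp v" using J(1) cd by (auto simp: supp_v)
      moreover have "a \<in> ?J" "a \<notin> supp v" using J(1) \<open>a < b\<close> by (auto simp: supp_v)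
      moreover have "b \<notin> ?J" "b \<in> supp v" using J(2) \<open>a < b\<close> cd by (auto simp: supp_v)
      ultimately show ?thesis unfolding \<open>i = p\<close> pn(4) F_n F_low[OF order_refl] by blast
    next
      assume "i = n"
      obtain z where "c < z" "z < d" using dense[OF cd(2)] by blast
      then have "z \<in> supp v" "z \<in> supp w"
        using \<open>a < b\<close> cd E(2)[of z d] by (auto simp: supp_v supp_w)
      moreover have "c \<in> supp v" "c \<notin> supp w" using \<open>a < b\<close> cd by (auto simp: supp_v supp_w)
      moreover have "d \<notin> supp v" "d \<in> supp w" using cd by (auto simp: supp_v supp_w)
      ultimately show ?thesis
        unfolding \<open>i = n\<close> Suc_eq_plus1[symmetric] F_n F_Suc by blast
    qed
    then show "supp (F i) \<inter> supp (F (i + 1)) \<noteq> {}"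
      "supp (F i) \<inter> supp (F (i + 1)) \<subset> supp (F i)"
      "supp (F i) \<inter> supp (F (i + 1)) \<subset> supp (F (i + 1))" by blast+
  qed
  moreover have "F i \<in> carrier Homeo_plus \<and> (\<forall>t. t \<le> F i t)" if "i \<in> {1..Suc n}" for i
    using that by (rule cases) (use f ge v w v_ge w_ge n in \<open>simp_all add: F_low F_n F_Suc\<close>)
  moreover have "left_endpoint (supp (F i)) < left_endpoint (supp (F (i + 1)))"
    if "i \<in> {1..<Suc n}" for i
    using that
  proof (rule step_cases)
    assume "i \<in> {1..<n}" "i + 1 \<le> p"
    then show ?thesis using left[of i] by (simp add: F_low)
  next
    assume "i = p"
    have "left_endpoint ?J < left_endpoint ?K" using left[OF pn(3)] unfolding pn(4) .
    also have "\<dots> \<le> left_endpoint (supp v)"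
      unfolding left_endpoint_def by (rule INF_superset_mono[OF vK]) simp
    finally show ?thesis unfolding \<open>i = p\<close> pn(4) F_n F_low[OF order_refl] .
  next
    assume "i = n"
    obtain z where z: "a < z" "z < b" using dense[OF \<open>a < b\<close>] by blast
    then have "left_endpoint (supp v) \<le> ereal z"
      unfolding left_endpoint_def supp_v using cd by (intro INF_lower) auto
    also have "\<dots> < ereal c" using z cd by simp
    also have "\<dots> \<le> left_endpoint (supp w)"
      unfolding left_endpoint_def supp_w by (intro INF_greatest) auto
    finally show ?thesis unfolding \<open>i = n\<close> Suc_eq_plus1[symmetric] F_n F_Suc .
  qed
  moreover have "subgroup_generated Homeo_plus {F i, F (i + 1)} \<cong> thompson_F"
    if "i \<in> {1..<Suc n}" for i
    using that
  proof (rule step_cases)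
    assume "i \<in> {1..<n}" "i + 1 \<le> p"
    then show ?thesis using iso[of i] by (simp add: F_low)
  next
    assume "i = p"
    have "subgroup_generated Homeo_plus {f p, v} \<cong> thompson_F"
      using iso_trans[OF iso_fv] iso[OF pn(3)] unfolding pn(4) .
    then show ?thesis unfolding \<open>i = p\<close> pn(4) F_n F_low[OF order_refl] .
  next
    assume "i = n"
    show ?thesis unfolding \<open>i = n\<close> Suc_eq_plus1[symmetric] F_n F_Suc by (rule iso_vw)
  qed
  moreover have "G = subgroup_generated Homeo_plus (F ` {1..Suc n})"
    unfolding G
  proof (rule group.subgroup_generated_eqI[OF group_Homeo_plus])
    show f_carr: "f ` {1..n} \<subseteq> carrier Homeo_plus" using f by blast
    show F_carr: "F ` {1..Suc n} \<subseteq> carrier Homeo_plus" using calculation(2) by blast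
    let ?A = "generate Homeo_plus (f ` {1..n})" and ?B = "generate Homeo_plus (F ` {1..Suc n})"
    have A: "subgroup ?A Homeo_plus"
      by (rule group.generate_is_subgroup[OF group_Homeo_plus f_carr])
    have B: "subgroup ?B Homeo_plus"
      by (rule group.generate_is_subgroup[OF group_Homeo_plus F_carr])
    have fA: "f i \<in> ?A" if "i \<in> {1..n}" for i using that by (auto intro: generate.incl)
    have FB: "F i \<in> ?B" if "i \<in> {1..Suc n}" for i using that by (auto intro: generate.incl)
    have "generate Homeo_plus {f p, f n} \<subseteq> ?A"
      using fA pn by (intro group.generate_subgroup_incl[OF group_Homeo_plus _ A]) auto
    with gen have vwA: "v \<in> ?A" "w \<in> ?A" by auto
    have "F i \<in> ?A" if "i \<in> {1..Suc n}" for i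
      using that by (rule cases) (use vwA fA n in \<open>simp_all add: F_low F_n F_Suc\<close>)
    then show "F ` {1..Suc n} \<subseteq> ?A" by blast
    have "v \<circ> w \<in> ?B"
      using FB[of n] FB[of "Suc n"] p n by (intro subgroup_Homeo_plus_comp[OF B]) (simp_all add: F_n F_Suc)
    then have "f n \<in> ?B" by (simp add: vw)
    moreover have "f i \<in> ?B" if "1 \<le> i" "i \<le> p" for i
      using FB[of i] that n by (simp add: F_low)
    ultimately have "f i \<in> ?B" if "i \<in> {1..n}" for i
      using that n by (cases "i = n") auto
    then show "f ` {1..n} \<subseteq> ?B" by blast
  qed
  ultimately show ?thesis
    unfolding chain_group_def using \<open>2 \<le> n\<close> by (intro conjI exI[of _ F]) auto
qed

theorem proposition1p5:
  fixes n m :: nat and G :: "(real \<Rightarrow> real) monoid"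
  assumes "n \<ge> 2" and "m \<ge> n" and "chain_group n G"
  shows "\<exists>H. chain_group m H \<and> G \<cong> H"
proof -
  have "chain_group m G"
    using assms(2,3) by (induction m rule: dec_induct) (auto intro: chain_group_Suc)
  then show ?thesis by (intro exI[of _ G]) simp
qed

end
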